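(* Let $Q_e(x,y)\equiv Q_e(t;x,y)$ be the generating function of spiral walks in the quarter plane that end with an east step. Then $$Q_e(x,y)=-\frac{y^{-1}(1-ty)}{y-t}\,[x^{>}y^{>}]\,\mathrm{RHS}_e,$$ where $$\mathrm{RHS}_e=-\frac{tx(1-y^2)\left(t^3-2t^2x+tx^2-t^2y+2txy+2t^3xy-x^2y-t^2x^2y+t^3y^2-2t^2xy^2+tx^2y^2\right)}{(x-t)^2(y-t)(1-ty)^2\,(1-B_e(x,y))}$$ and $$B_e(x,y)=\frac{tx\left(t^2-tx-ty+xy+t^2xy+t^2y^2-txy^2\right)}{(x-t)(y-t)(1-ty)};$$ its expansion begins $$Q_e(x,y)=tx+t^2x^2+t^3x^3+t^4x^4+t^5(x+x^5)+t^6(2x^2+x^6+xy)+O(t^7).$$ Moreover, being the positive part of a rational function, $Q_e(x,y)$ is D-finite.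
   Context: Steps on $\mathbb Z^2$: east $(1,0)$, north $(0,1)$, west $(-1,0)$, south $(0,-1)$. Spiral walks are walks in which each step is followed either by a step in the same direction or by a left turn: east may be followed by east or north; north by north or west; west by west or south; south by south or east; no other consecutive pairs are allowed. A quarter-plane spiral walk is a nonempty finite spiral walk starting at the origin and staying in $\{(a,b):a\ge0,\ b\ge0\}$. (The first step may be in any direction that keeps the walk in the quarter plane.) $Q_e(t;x,y)=\sum t^m x^a y^b$, summed over all quarter-plane spiral walks whose last step is east, where $m$ is the length and $(a,b)$ the endpoint. Rational functions are expanded as power series in $t$ whose coefficients are Laurent polynomials in $x,y$. For such a series, $[x^{>}y^{>}]$ denotes extraction of the part consisting of all terms in which the exponents of both $x$ and $y$ are strictly positive. D-finite means that the (partial) derivatives span a finite-dimensional vector space over the field of rational functions in $t,x,y$ (i.e. the series satisfies linear differential equations with polynomial coefficients in each variable). *)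

theory Defs
  imports
    "HOL-Library.Poly_Mapping"
    "HOL-Computational_Algebra.Computational_Algebra"
begin

datatype step = East | North | West | South

fun step_vec :: "step \<Rightarrow> int \<times> int" where
  "step_vec East = (1, 0)"
| "step_vec North = (0, 1)"
| "step_vec West = (-1, 0)"
| "step_vec South = (0, -1)"

fun left_turn :: "step \<Rightarrow> step" where
  "left_turn East = North"
| "left_turn North = West"
| "left_turn West = South"
| "left_turn South = East"

text \<open>A walk from the origin is the list of its steps.\<close>

definition xpos :: "step list \<Rightarrow> int" where
  "xpos w = (\<Sum>s\<leftarrow>w. fst (step_vec s))"

definition ypos :: "step list \<Rightarrow> int" where
  "ypos w = (\<Sum>s\<leftarrow>w. snd (step_vec s))"

definition spiral :: "step list \<Rightarrow> bool" where
  "spiral w \<longleftrightarrow> successively (\<lambda>s s'. s' = s \<or> s' = left_turn s) w"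

definition in_quarter_plane :: "step list \<Rightarrow> bool" where
  "in_quarter_plane w \<longleftrightarrow> (\<forall>k\<le>length w. 0 \<le> xpos (take k w) \<and> 0 \<le> ypos (take k w))"

definition quarter_plane_spiral_walks :: "step list set" where
  "quarter_plane_spiral_walks = {w. w \<noteq> [] \<and> spiral w \<and> in_quarter_plane w}"

definition east_walks :: "nat \<Rightarrow> step list set" where
  "east_walks m = {w \<in> quarter_plane_spiral_walks. last w = East \<and> length w = m}"

lemma finite_east_walks: "finite (east_walks m)"
proof -
  have fin: "finite (UNIV :: step set)"
    by (rule finite_subset[of _ "{East, North, West, South}"]) (use step.exhaust in auto)
  have "finite {w :: step list. set w \<subseteq> UNIV \<and> length w = m}"
    by (rule finite_lists_length_eq[OF fin])
  then show ?thesis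
    by (rule finite_subset[rotated]) (auto simp: east_walks_def)
qed

text \<open>
  A Laurent polynomial in \<open>x, y\<close> is represented as a Laurent polynomial in \<open>y\<close> whose coefficients
  are Laurent polynomials in \<open>x\<close>: the outer exponent is that of \<open>y\<close>, the inner one that of \<open>x\<close>.
  The nesting (rather than exponents of type \<open>int \<times> int\<close>) makes the coefficient ring, and hence
  the ring of power series, an instance of \<^class>\<open>idom\<close>.
\<close>

type_synonym laurent = "int \<Rightarrow>\<^sub>0 (int \<Rightarrow>\<^sub>0 rat)"

type_synonym series = "laurent fps"

definition xy_mono :: "int \<Rightarrow> int \<Rightarrow> laurent" where
  "xy_mono a b = Poly_Mapping.single b (Poly_Mapping.single a 1)"

definition Q_e :: series where
  "Q_e = Abs_fps (\<lambda>m. \<Sum>w\<in>east_walks m. xy_mono (xpos w) (ypos w))"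

definition pos_part_laurent :: "laurent \<Rightarrow> laurent" where
  "pos_part_laurent =
    Poly_Mapping.mapp (\<lambda>b q.
      if b > 0 then Poly_Mapping.mapp (\<lambda>a c. if a > 0 then c else 0) q else 0)"

definition pos_part :: "series \<Rightarrow> series" where
  "pos_part F = Abs_fps (\<lambda>n. pos_part_laurent (fps_nth F n))"

lemma lookup_pos_part_laurent:
  "Poly_Mapping.lookup (Poly_Mapping.lookup (pos_part_laurent p) b) a =
    (if a > 0 \<and> b > 0 then Poly_Mapping.lookup (Poly_Mapping.lookup p b) a else 0)"
  by (auto simp: pos_part_laurent_def lookup_mapp when_def in_keys_iff)

text \<open>
  Rational functions in \<open>t, x, y\<close> are elements of the fraction field of the ring of power series in \<open>t\<close>
  over the Laurent polynomials. Such an element has an expansion if it is the image of a series,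
  which is then unique.
\<close>

definition vt :: "series fract" where
  "vt = to_fract fps_X"

definition vx :: "series fract" where
  "vx = to_fract (fps_const (xy_mono 1 0))"

definition vy :: "series fract" where
  "vy = to_fract (fps_const (xy_mono 0 1))"

definition expansion :: "series fract \<Rightarrow> series" where
  "expansion r = (THE S. to_fract S = r)"

lemma expansion_to_fract [simp]: "expansion (to_fract S) = S"
  unfolding expansion_def by (rule the_equality) auto

definition B_e :: "series fract" where
  "B_e =
    vt * vx * (vt^2 - vt * vx - vt * vy + vx * vy + vt^2 * vx * vy + vt^2 * vy^2 - vt * vx * vy^2)
    / ((vx - vt) * (vy - vt) * (1 - vt * vy))"

definition RHS_e :: "series fract" where
  "RHS_e =
    - (vt * vx * (1 - vy^2) *
        (vt^3 - 2 * vt^2 * vx + vt * vx^2 - vt^2 * vy + 2 * vt * vx * vy + 2 * vt^3 * vx * vy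
          - vx^2 * vy - vt^2 * vx^2 * vy + vt^3 * vy^2 - 2 * vt^2 * vx * vy^2 + vt * vx^2 * vy^2)
      / ((vx - vt)^2 * (vy - vt) * (1 - vt * vy)^2 * (1 - B_e)))"

lemma to_fract_inverse_ex:
  assumes "fps_nth (D :: series) 0 * u = 1"
  shows "\<exists>S. inverse (to_fract D) = to_fract S"
proof -
  have "D * fps_right_inverse D u = 1"
    using assms by (intro fps_right_inverse)
  then have "to_fract D * to_fract (fps_right_inverse D u) = 1"
    by (metis to_fract_1 to_fract_mult)
  then show ?thesis
    using inverse_unique by blast
qed

lemma xy_mono_mult: "xy_mono a b * xy_mono c d = xy_mono (a + c) (b + d)"
  by (simp add: xy_mono_def mult_single)

lemma xy_mono_0_0: "xy_mono 0 0 = 1"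
  by (simp add: xy_mono_def)

lemma RHS_e_has_expansion: "to_fract (expansion RHS_e) = RHS_e"
proof -
  define X :: series where "X = fps_const (xy_mono 1 0)"
  define Y :: series where "Y = fps_const (xy_mono 0 1)"
  define T :: series where "T = fps_X"
  have v: "vt = to_fract T" "vx = to_fract X" "vy = to_fract Y"
    by (simp_all add: vt_def vx_def vy_def X_def Y_def T_def)
  have "\<exists>S. inverse (to_fract (X - T)) = to_fract S"
    by (rule to_fract_inverse_ex[of _ "xy_mono (-1) 0"])
       (simp add: X_def T_def xy_mono_mult xy_mono_0_0)
  then obtain S1 where S1: "inverse (to_fract (X - T)) = to_fract S1" ..
  have "\<exists>S. inverse (to_fract (Y - T)) = to_fract S"
    by (rule to_fract_inverse_ex[of _ "xy_mono 0 (-1)"])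
       (simp add: Y_def T_def xy_mono_mult xy_mono_0_0)
  then obtain S2 where S2: "inverse (to_fract (Y - T)) = to_fract S2" ..
  have "\<exists>S. inverse (to_fract (1 - T * Y)) = to_fract S"
    by (rule to_fract_inverse_ex[of _ 1]) (simp add: T_def)
  then obtain S3 where S3: "inverse (to_fract (1 - T * Y)) = to_fract S3" ..
  define B where "B = T * X * (T^2 - T * X - T * Y + X * Y + T^2 * X * Y + T^2 * Y^2 - T * X * Y^2)
      * (S1 * S2 * S3)"
  have pow: "to_fract (a ^ n) = to_fract a ^ n" for a :: series and n
    by (induction n) auto
  have B: "B_e = to_fract B"
    unfolding B_e_def v divide_inverse B_def
    by (simp add: pow S1[symmetric] S2[symmetric] S3[symmetric])
  have "\<exists>S. inverse (to_fract (1 - B)) = to_fract S"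
    by (rule to_fract_inverse_ex[of _ 1]) (simp add: T_def B_def)
  then obtain S4 where S4: "inverse (to_fract (1 - B)) = to_fract S4" ..
  have num: "to_fract 2 = (2 :: series fract)"
    by (metis one_add_one to_fract_1 to_fract_add)
  have "RHS_e = to_fract (- (T * X * (1 - Y^2) *
        (T^3 - 2 * T^2 * X + T * X^2 - T^2 * Y + 2 * T * X * Y + 2 * T^3 * X * Y
          - X^2 * Y - T^2 * X^2 * Y + T^3 * Y^2 - 2 * T^2 * X * Y^2 + T * X^2 * Y^2)
      * (S1^2 * S2 * S3^2 * S4)))"
    unfolding RHS_e_def v divide_inverse B
    by (simp add: pow num S1[symmetric] S2[symmetric] S3[symmetric] S4[symmetric] power_inverse)
  then show ?thesis
    by (metis expansion_to_fract)
qed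

definition laurent_deriv :: "(int \<Rightarrow>\<^sub>0 'a::comm_ring_1) \<Rightarrow> (int \<Rightarrow>\<^sub>0 'a)" where
  "laurent_deriv p =
    (\<Sum>k\<in>Poly_Mapping.keys p. Poly_Mapping.single (k - 1) (of_int k * Poly_Mapping.lookup p k))"

definition deriv_t :: "series \<Rightarrow> series" where
  "deriv_t = fps_deriv"

definition deriv_x :: "series \<Rightarrow> series" where
  "deriv_x F = Abs_fps (\<lambda>n. Poly_Mapping.map laurent_deriv (fps_nth F n))"

definition deriv_y :: "series \<Rightarrow> series" where
  "deriv_y F = Abs_fps (\<lambda>n. laurent_deriv (fps_nth F n))"

lemma lookup_laurent_deriv:
  "Poly_Mapping.lookup (laurent_deriv p) k = of_int (k + 1) * Poly_Mapping.lookup p (k + 1)"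
proof -
  have "Poly_Mapping.lookup (laurent_deriv p) k =
      (\<Sum>j\<in>Poly_Mapping.keys p. if j = k + 1 then of_int j * Poly_Mapping.lookup p j else 0)"
    unfolding laurent_deriv_def lookup_sum
    by (rule sum.cong) (auto simp: lookup_single when_def)
  also have "\<dots> = of_int (k + 1) * Poly_Mapping.lookup p (k + 1)"
    by (auto simp: sum.delta in_keys_iff)
  finally show ?thesis .
qed

text \<open>
  The field of rational functions in \<open>t, x, y\<close> over the rationals, as the subfield generated by the
  variables; the rational constants are quotients of sums of \<open>\<plusminus>1\<close>.
\<close>

inductive_set ratfuns :: "series fract set" where
  one: "1 \<in> ratfuns"
| var_t: "vt \<in> ratfuns"
| var_x: "vx \<in> ratfuns"
| var_y: "vy \<in> ratfuns"
| add: "f \<in> ratfuns \<Longrightarrow> g \<in> ratfuns \<Longrightarrow> f + g \<in> ratfuns"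
| uminus: "f \<in> ratfuns \<Longrightarrow> - f \<in> ratfuns"
| mult: "f \<in> ratfuns \<Longrightarrow> g \<in> ratfuns \<Longrightarrow> f * g \<in> ratfuns"
| inverse: "f \<in> ratfuns \<Longrightarrow> inverse f \<in> ratfuns"

definition ratfun_span :: "series fract set \<Rightarrow> series fract set" where
  "ratfun_span A = {\<Sum>b\<in>B. c b * b | B c. finite B \<and> B \<subseteq> A \<and> (\<forall>b\<in>B. c b \<in> ratfuns)}"

definition partial_derivs :: "series \<Rightarrow> series fract set" where
  "partial_derivs F =
    {to_fract ((deriv_t ^^ i) ((deriv_x ^^ j) ((deriv_y ^^ k) F))) | i j k. True}"

text \<open>
  The span of the partial derivatives is finite-dimensional iff finitely many of them span it.
\<close>

definition D_finite :: "series \<Rightarrow> bool" where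
  "D_finite F \<longleftrightarrow>
    (\<exists>B. finite B \<and> B \<subseteq> partial_derivs F \<and> ratfun_span (partial_derivs F) = ratfun_span B)"

end

theory Submission
  imports Defs
begin

text \<open>
  \<^bold>\<open>The formula.\<close> Sorting the walks by their last step, and deleting that step, gives four linear
  equations between the series \<open>E, N, W, S\<close> of the walks that end east, north, west and south
  (\<open>last_step_equations\<close>). East and north steps never leave the quarter plane. The west steps that do
  are removed through a series \<open>V(y)\<close>, and the south steps that do through a series \<open>H(x)\<close>.
  Eliminating \<open>N, W, S\<close> leaves
  \<open>K E = tx ((y-t)(x-t)(1-ty) + t\<^sup>3 y - t\<^sup>2 (1-ty) V(y) - t (x-t)(1-ty) H(x))\<close> with
  \<open>K = (1-tx)(1-ty)(x-t)(y-t) - t\<^sup>4 xy\<close>. Up to a monomial factor \<open>K\<close> is invariant under \<open>x \<mapsto> 1/x\<close>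
  and under \<open>y \<mapsto> 1/y\<close>; the coefficient of \<open>V(y)\<close> in \<open>E\<close> is invariant under the first of these, and
  \<open>y-t\<close> times the coefficient of \<open>H(x)\<close> in \<open>E\<close> under the second. Hence both unknown series cancel in
  \<open>y(y-t) (E(x,y) - E(1/x,y)) - (1-ty) (E(x,1/y) - E(1/x,1/y))\<close>,
  which is therefore rational (\<open>antisymmetrised_kernel_equation\<close>). Divided by \<open>1-ty\<close>, only
  the first of its four terms contributes monomials with positive exponents of both variables, and it
  contains no others, so the positive part of the quotient is \<open>y(y-t)/(1-ty) E(x,y)\<close>. The rational
  function \<open>RHS_e\<close> is the negative of this quotient, up to the term
  \<open>(1 - y(y-t)/(1-ty)) t/(x-t)\<close>, whose expansion has only negative exponents of \<open>x\<close>.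

  \<^bold>\<open>D-finiteness.\<close> The argument is the dimension count of Bernstein. Call a series holonomic if it
  lies in the first member of an increasing sequence \<open>V\<^sub>0 \<subseteq> V\<^sub>1 \<subseteq> \<dots>\<close> of rational vector spaces such
  that multiplication by \<open>t, x, 1/x, y, 1/y\<close> and the derivations \<open>\<partial>/\<partial>t, x \<partial>/\<partial>x, y \<partial>/\<partial>y\<close> map
  \<open>V\<^sub>N\<close> to \<open>V\<^sub>N\<^sub>+\<^sub>1\<close> and \<open>dim V\<^sub>N\<close> grows at most like \<open>N\<^sup>3\<close>. The constant series \<open>1\<close> is holonomic, and
  division by a Laurent polynomial preserves holonomicity (\<open>holonomic_quotient\<close>), so rational series
  are holonomic. Taking the positive part in one variable \<open>z\<close> preserves it too
  (\<open>holonomic_positive_part\<close>): the operators commute with it up to multiples \<open>z\<^sup>k [z\<^sup>0]v\<close> of constant terms, and these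
  contribute no more than the dimension of a later member of the sequence. Finally, \<open>M\<close> partial
  derivatives of a holonomic series which are linearly independent over the rational functions would
  yield, on multiplication by the monomials \<open>t\<^sup>i x\<^sup>j y\<^sup>k\<close> with \<open>i, j, k \<le> N\<close>, \<open>M (N+1)\<^sup>3\<close>
  series independent over the rationals inside a space of dimension \<open>O(N\<^sup>3)\<close>; so \<open>M\<close> is
  bounded (\<open>D_finite_if_holonomic\<close>).
\<close>

section \<open>Coefficients of series\<close>


definition cf :: "series \<Rightarrow> nat \<Rightarrow> int \<Rightarrow> int \<Rightarrow> rat" where
  "cf F n a b = Poly_Mapping.lookup (Poly_Mapping.lookup (fps_nth F n) b) a"

lemma series_eqI: "(\<And>n a b. cf F n a b = cf G n a b) \<Longrightarrow> F = G"
  unfolding cf_def by (intro fps_ext poly_mapping_eqI) blast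

lemma cf_add [simp]: "cf (F + G) n a b = cf F n a b + cf G n a b"
  and cf_diff [simp]: "cf (F - G) n a b = cf F n a b - cf G n a b"
  and cf_uminus [simp]: "cf (- F) n a b = - cf F n a b"
  and cf_0 [simp]: "cf 0 n a b = 0"
  by (simp_all add: cf_def lookup_add lookup_minus)

lemma cf_sum: "cf (sum f A) n a b = (\<Sum>i\<in>A. cf (f i) n a b)"
  by (induction A rule: infinite_finite_induct) auto

lemma poly_mapping_sum_induct [case_names zero single add]:
  fixes p :: "'k \<Rightarrow>\<^sub>0 'c::comm_monoid_add"
  assumes "P 0" "\<And>k c. P (Poly_Mapping.single k c)" "\<And>f g. P f \<Longrightarrow> P g \<Longrightarrow> P (f + g)"
  shows "P p"
proof (induction p rule: update_induct)
  case const
  show ?case by (rule assms(1))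
next
  case (update f k c)
  have "Poly_Mapping.update k c f = f + Poly_Mapping.single k c"
    using update by (intro poly_mapping_eqI)
      (auto simp: lookup_update lookup_add lookup_single when_def in_keys_iff)
  then show ?case using assms update by simp
qed

lemma laurent_induct [case_names zero single add]:
  fixes p :: laurent
  assumes "P 0" "\<And>a b c. P (Poly_Mapping.single b (Poly_Mapping.single a c))"
    "\<And>f g. P f \<Longrightarrow> P g \<Longrightarrow> P (f + g)"
  shows "P p"
proof (induction p rule: poly_mapping_sum_induct)
  case (single b q)
  show ?case
    by (induction q rule: poly_mapping_sum_induct) (simp_all add: assms single_add)
qed (use assms in auto)

definition mon :: "nat \<Rightarrow> int \<Rightarrow> int \<Rightarrow> series" where
  "mon n i j = fps_X ^ n * fps_const (xy_mono i j)"

definition rat_const :: "rat \<Rightarrow> series" where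
  "rat_const c = fps_const (Poly_Mapping.single 0 (Poly_Mapping.single 0 c))"

lemma lookup_xy_mono_mult:
  "Poly_Mapping.lookup (Poly_Mapping.lookup (xy_mono i j * p) b) a =
    Poly_Mapping.lookup (Poly_Mapping.lookup p (b - j)) (a - i)"
  by (induction p rule: laurent_induct)
     (auto simp: xy_mono_def mult_single lookup_single when_def distrib_left lookup_add)

lemma cf_mon_mult:
  "cf (mon n i j * F) m a b = (if n \<le> m then cf F (m - n) (a - i) (b - j) else 0)"
  by (simp add: cf_def mon_def mult.assoc fps_X_power_mult_nth lookup_xy_mono_mult)

lemma cf_rat_const_mult [simp]: "cf (rat_const c * F) n a b = c * cf F n a b"
proof -
  have "Poly_Mapping.lookup (Poly_Mapping.lookup
      (Poly_Mapping.single 0 (Poly_Mapping.single 0 c) * p) b) a =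
      c * Poly_Mapping.lookup (Poly_Mapping.lookup p b) a" for p :: laurent
    by (induction p rule: laurent_induct)
       (auto simp: mult_single lookup_single when_def distrib_left lookup_add)
  then show ?thesis by (simp add: cf_def rat_const_def)
qed

lemma cf_1: "cf 1 n a b = (if n = 0 \<and> a = 0 \<and> b = 0 then 1 else 0)"
  by (auto simp: cf_def lookup_one when_def)

lemma mon_0 [simp]: "mon 0 0 0 = 1"
  by (simp add: mon_def xy_mono_0_0)

lemma mon_mult: "mon n i j * mon m k l = mon (n + m) (i + k) (j + l)"
proof -
  have *: "fps_const (xy_mono i j) * fps_const (xy_mono k l) = fps_const (xy_mono (i + k) (j + l))"
    by (simp add: xy_mono_mult)
  show ?thesis
    by (simp only: mon_def power_add mult_ac flip: *)
qed

lemma cf_mon: "cf (mon n i j) m a b = (if m = n \<and> a = i \<and> b = j then 1 else 0)"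
  using cf_mon_mult[of n i j 1] by (auto simp: cf_1)

text \<open>
  Operators that act diagonally on monomials: the Euler operators \<open>x \<partial>/\<partial>x\<close> and \<open>y \<partial>/\<partial>y\<close> are the cases
  \<open>w a b = a\<close> and \<open>w a b = b\<close>, and extraction of a part of a series is the case of an indicator
  function \<open>w\<close>. Hence all of them commute with each other.
\<close>

definition diag :: "(int \<Rightarrow> int \<Rightarrow> rat) \<Rightarrow> series \<Rightarrow> series" where
  "diag w F = Abs_fps (\<lambda>n.
    Poly_Mapping.mapp (\<lambda>b. Poly_Mapping.mapp (\<lambda>a c. w a b * c)) (fps_nth F n))"

lemma cf_diag [simp]: "cf (diag w F) n a b = w a b * cf F n a b"
  by (auto simp: cf_def diag_def lookup_mapp when_def in_keys_iff)

lemma cf_deriv_t [simp]: "cf (deriv_t F) n a b = of_nat (Suc n) * cf F (Suc n) a b"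
proof -
  have "fps_nth (deriv_t F) n = of_nat (Suc n) * fps_nth F (Suc n)"
    by (simp add: deriv_t_def)
  moreover have "of_nat k * p = Poly_Mapping.single 0 (Poly_Mapping.single 0 (of_nat k)) * p"
    for k and p :: laurent
    by (simp only: single_of_nat)
  ultimately show ?thesis
    using cf_rat_const_mult[of "of_nat (Suc n)" F "Suc n" a b]
    by (simp only: cf_def rat_const_def fps_mult_left_const_nth)
qed

lemma deriv_x_eq: "deriv_x F = mon 0 (-1) 0 * diag (\<lambda>a b. of_int a) F"
  by (rule series_eqI, subst cf_mon_mult)
     (auto simp: cf_def diag_def lookup_mapp deriv_x_def Poly_Mapping.map.rep_eq lookup_laurent_deriv 
        when_def in_keys_iff)

lemma deriv_y_eq: "deriv_y F = mon 0 0 (-1) * diag (\<lambda>a b. of_int b) F"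
proof (rule series_eqI)
  fix n a b
  define q where "q = Poly_Mapping.lookup (fps_nth F n) (b + 1)"
  have mult: "Poly_Mapping.lookup (Poly_Mapping.single 0 c * p) i = c * Poly_Mapping.lookup p i"
    for c i and p :: "int \<Rightarrow>\<^sub>0 rat"
    by (induction p rule: poly_mapping_sum_induct)
       (auto simp: mult_single lookup_single when_def distrib_left lookup_add)
  have "cf (deriv_y F) n a b = Poly_Mapping.lookup (of_int (b + 1) * q) a"
    by (simp only: cf_def deriv_y_def lookup_laurent_deriv fps_nth_Abs_fps q_def)
  also have "\<dots> = of_int (b + 1) * Poly_Mapping.lookup q a"
    by (simp only: single_of_int[symmetric] mult)
  finally show "cf (deriv_y F) n a b = cf (mon 0 0 (-1) * diag (\<lambda>a b. of_int b) F) n a b"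
    by (simp add: cf_mon_mult) (simp add: cf_def q_def)
qed

text \<open>
  An additive weight is a degree function, and a degree function acts as a derivation, because both
  sides are bilinear and agree on monomials.
\<close>

lemma diag_mult:
  assumes "\<And>a b c d. w (a + c) (b + d) = w a b + w c d"
  shows "diag w (F * G) = diag w F * G + F * diag w G"
proof -
  define dl :: "laurent \<Rightarrow> laurent" where
    "dl = Poly_Mapping.mapp (\<lambda>b. Poly_Mapping.mapp (\<lambda>a c. w a b * c))"
  have lookup_dl: "Poly_Mapping.lookup (Poly_Mapping.lookup (dl p) b) a =
      w a b * Poly_Mapping.lookup (Poly_Mapping.lookup p b) a" for p a b
    by (auto simp: dl_def lookup_mapp when_def in_keys_iff)
  have dl_add: "dl (p + q) = dl p + dl q" for p q
    by (intro poly_mapping_eqI) (simp add: lookup_dl lookup_add distrib_left)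
  have dl_0: "dl 0 = 0"
    by (intro poly_mapping_eqI) (simp add: lookup_dl)
  have dl_single: "dl (Poly_Mapping.single b (Poly_Mapping.single a c)) =
      Poly_Mapping.single b (Poly_Mapping.single a (w a b * c))" for a b c
    by (intro poly_mapping_eqI) (auto simp: lookup_dl lookup_single when_def)
  have "dl (p * q) = dl p * q + p * dl q" for p q
  proof (induction p rule: laurent_induct)
    case (single a b c)
    show ?case
    proof (induction q rule: laurent_induct)
      case (single a' b' c')
      show ?case
        by (simp add: dl_single mult_single single_add[symmetric] assms algebra_simps)
    qed (simp_all add: dl_0 dl_add algebra_simps)
  qed (simp_all add: dl_0 dl_add algebra_simps)
  moreover have "dl (sum f A) = (\<Sum>i\<in>A. dl (f i))" for f and A :: "nat set"
    by (induction A rule: infinite_finite_induct) (simp_all add: dl_0 dl_add)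
  ultimately show ?thesis
    by (intro fps_ext) (simp add: diag_def dl_def[symmetric] fps_mult_nth sum.distrib)
qed

section \<open>Series as a vector space over the rationals\<close>

abbreviation qscale :: "rat \<Rightarrow> series \<Rightarrow> series" where
  "qscale c F \<equiv> rat_const c * F"

lemma const_add: "rat_const (c + d) = rat_const c + rat_const d"
  and const_mult: "rat_const (c * d) = rat_const c * rat_const d"
  and const_1 [simp]: "rat_const 1 = 1"
  by (simp_all add: rat_const_def single_add mult_single)

interpretation Q: vector_space qscale
  by unfold_locales (simp_all add: const_add const_mult algebra_simps)

abbreviation qlinear :: "(series \<Rightarrow> series) \<Rightarrow> bool" where
  "qlinear \<equiv> Vector_Spaces.linear qscale qscale"

interpretation QQ: vector_space_pair qscale qscale
  by unfold_locales

lemma qlinearI: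
  assumes "\<And>F G. f (F + G) = f F + f G" "\<And>c F. f (qscale c F) = qscale c (f F)"
  shows "qlinear f"
  unfolding Vector_Spaces.linear_iff using assms Q.vector_space_axioms by blast

lemma qlinear_mult: "qlinear ((*) F)"
  by (rule qlinearI) (simp_all add: algebra_simps)

lemma qlinear_diag: "qlinear (diag w)"
  by (rule qlinearI; rule series_eqI) (simp_all add: distrib_left)

lemma qlinear_deriv_t: "qlinear deriv_t"
  by (rule qlinearI; rule series_eqI) (simp_all add: distrib_left del: of_nat_Suc)

lemma qlinear_span:
  assumes "qlinear f" "v \<in> Q.span A" "\<And>g. g \<in> A \<Longrightarrow> f g \<in> Q.span B"
  shows "f v \<in> Q.span B"
proof -
  have "f v \<in> Q.span (f ` A)"
    using QQ.linear_span_image[OF assms(1), of A] assms(2) by auto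
  then show ?thesis
    using Q.span_minimal[of "f ` A" "Q.span B"] assms(3) by auto
qed

definition dim_le :: "series set \<Rightarrow> nat \<Rightarrow> bool" where
  "dim_le V m \<longleftrightarrow> (\<exists>T. finite T \<and> card T \<le> m \<and> V \<subseteq> Q.span T)"

lemma dim_le_injective_image:
  assumes "Q.subspace U" "qlinear f" "inj f" "f ` U \<subseteq> V" "dim_le V m"
  shows "dim_le U m"
proof -
  obtain T where T: "finite T" "card T \<le> m" "V \<subseteq> Q.span T"
    using assms(5) by (auto simp: dim_le_def)
  obtain B where B: "B \<subseteq> U" "Q.independent B" "U \<subseteq> Q.span B"
    by (metis Q.basis_exists[of U])
  have "Q.independent (f ` B)"
    using QQ.linear_independent_injective_image[OF assms(2) B(2)] assms(3)
    by (meson inj_on_subset subset_UNIV)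
  moreover have "f ` B \<subseteq> Q.span T"
    using B(1) assms(4) T(3) by blast
  ultimately have *: "finite (f ` B)" "card (f ` B) \<le> card T"
    using Q.independent_span_bound[OF T(1)] by auto
  have "inj_on f B" using assms(3) by (meson inj_on_subset subset_UNIV)
  then have "finite B" "card B \<le> m"
    using *(1) by (rule finite_imageD[rotated])
      (use * T(2) card_image[OF \<open>inj_on f B\<close>] in linarith)
  then show ?thesis using B(3) by (auto simp: dim_le_def)
qed

section \<open>Holonomic series\<close>

text \<open>
  The generators of the algebra of differential operators with Laurent polynomial coefficients in
  \<open>x, y\<close> and polynomial coefficients in \<open>t\<close>. The identity is included so that filtrations compatible
  with these operators are increasing. The Euler operators replace \<open>\<partial>/\<partial>x\<close> and \<open>\<partial>/\<partial>y\<close> because they commute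
  with the extraction of exponents.
\<close>

definition weyl_ops :: "(series \<Rightarrow> series) set" where
  "weyl_ops = {\<lambda>F. F, (*) (mon 1 0 0), (*) (mon 0 1 0), (*) (mon 0 (-1) 0),
     (*) (mon 0 0 1), (*) (mon 0 0 (-1)),
     deriv_t, diag (\<lambda>a b. of_int a), diag (\<lambda>a b. of_int b)}"

lemma weyl_ops_intros:
  "(\<lambda>F. F) \<in> weyl_ops" "deriv_t \<in> weyl_ops" "(*) (mon 1 0 0) \<in> weyl_ops"
  "(*) (mon 0 1 0) \<in> weyl_ops" "(*) (mon 0 (-1) 0) \<in> weyl_ops"
  "(*) (mon 0 0 1) \<in> weyl_ops" "(*) (mon 0 0 (-1)) \<in> weyl_ops"
  "diag (\<lambda>a b. of_int a) \<in> weyl_ops" "diag (\<lambda>a b. of_int b) \<in> weyl_ops"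
  unfolding weyl_ops_def by blast+

lemma qlinear_weyl_ops: "f \<in> weyl_ops \<Longrightarrow> qlinear f"
  unfolding weyl_ops_def
  by (elim insertE emptyE; hypsubst)
     (rule Q.linear_ident qlinear_mult qlinear_diag qlinear_deriv_t)+

text \<open>
  The exponent is the number of variables; the count in \<open>D_finite_if_holonomic\<close> fails for any faster
  polynomial growth.
\<close>

definition bernstein_filtration :: "(nat \<Rightarrow> series set) \<Rightarrow> bool" where
  "bernstein_filtration V \<longleftrightarrow> (\<forall>N. Q.subspace (V N)) \<and>
     (\<forall>f\<in>weyl_ops. \<forall>N. \<forall>v\<in>V N. f v \<in> V (Suc N)) \<and>
     (\<exists>C. \<forall>N. dim_le (V N) (C * (N + 1) ^ 3))"

definition holonomic :: "series \<Rightarrow> bool" where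
  "holonomic F \<longleftrightarrow> (\<exists>V. bernstein_filtration V \<and> F \<in> V 0)"

lemma bernstein_subspace: "bernstein_filtration V \<Longrightarrow> Q.subspace (V N)"
  and bernstein_op: "bernstein_filtration V \<Longrightarrow> f \<in> weyl_ops \<Longrightarrow> v \<in> V N \<Longrightarrow> f v \<in> V (Suc N)"
  and bernstein_dim: "bernstein_filtration V \<Longrightarrow> \<exists>C. \<forall>N. dim_le (V N) (C * (N + 1) ^ 3)"
  unfolding bernstein_filtration_def by blast+

lemma bernstein_mono:
  assumes "bernstein_filtration V" "M \<le> N" "v \<in> V M"
  shows "v \<in> V N"
  using assms(2)
proof (induction N rule: dec_induct)
  case (step n)
  from bernstein_op[OF assms(1) weyl_ops_intros(1) step.IH] show ?case by simp
qed (use assms(3) in simp)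

lemma weyl_ops_funpow:
  assumes "bernstein_filtration V" "f \<in> weyl_ops" "v \<in> V N"
  shows "(f ^^ k) v \<in> V (N + k)"
proof (induction k)
  case (Suc k)
  then show ?case using bernstein_op[OF assms(1,2)] by simp
qed (use assms(3) in simp)

lemma mon_funpow: "((*) (mon n i j) ^^ k) F = mon (k * n) (int k * i) (int k * j) * F"
proof (induction k)
  case (Suc k)
  have "((*) (mon n i j) ^^ Suc k) F = mon n i j * mon (k * n) (int k * i) (int k * j) * F"
    by (simp only: funpow.simps o_apply Suc mult.assoc)
  then show ?case by (simp only: mon_mult of_nat_Suc mult_Suc distrib_right mult_1)
qed simp

lemma bernstein_mon:
  assumes "bernstein_filtration V" "v \<in> V N"
  shows "mon n i j * v \<in> V (N + n + nat \<bar>i\<bar> + nat \<bar>j\<bar>)"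
proof -
  have "mon n 0 0 * v \<in> V (N + n)"
    using weyl_ops_funpow[OF assms(1) weyl_ops_intros(3) assms(2), of n]
    unfolding mon_funpow by simp
  moreover have "mon 0 i 0 * u \<in> V (M + nat \<bar>i\<bar>)" if "u \<in> V M" for u M
  proof (cases "i \<ge> 0")
    case True
    then show ?thesis
      using weyl_ops_funpow[OF assms(1) weyl_ops_intros(4) that, of "nat i"]
      unfolding mon_funpow by simp
  next
    case False
    then show ?thesis
      using weyl_ops_funpow[OF assms(1) weyl_ops_intros(5) that, of "nat (- i)"]
      unfolding mon_funpow by simp
  qed
  moreover have "mon 0 0 j * u \<in> V (M + nat \<bar>j\<bar>)" if "u \<in> V M" for u M
  proof (cases "j \<ge> 0")
    case True
    then show ?thesis
      using weyl_ops_funpow[OF assms(1) weyl_ops_intros(6) that, of "nat j"]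
      unfolding mon_funpow by simp
  next
    case False
    then show ?thesis
      using weyl_ops_funpow[OF assms(1) weyl_ops_intros(7) that, of "nat (- j)"]
      unfolding mon_funpow by simp
  qed
  ultimately have "mon 0 0 j * (mon 0 i 0 * (mon n 0 0 * v)) \<in> V (N + n + nat \<bar>i\<bar> + nat \<bar>j\<bar>)"
    by blast
  then show ?thesis by (simp add: mult.assoc[symmetric] mon_mult)
qed

definition laurent_polys :: "series set" where
  "laurent_polys = Q.span {mon n i j | n i j. True}"

lemma mon_laurent_polys [simp]: "mon n i j \<in> laurent_polys"
  unfolding laurent_polys_def by (rule Q.span_base) blast

lemma laurent_polys_diff: "p \<in> laurent_polys \<Longrightarrow> q \<in> laurent_polys \<Longrightarrow> p - q \<in> laurent_polys"
  and laurent_polys_uminus: "p \<in> laurent_polys \<Longrightarrow> - p \<in> laurent_polys"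
  unfolding laurent_polys_def by (rule Q.span_diff Q.span_neg; assumption)+

lemma laurent_polys_scale: "p \<in> laurent_polys \<Longrightarrow> qscale c p \<in> laurent_polys"
  unfolding laurent_polys_def by (rule Q.span_scale)

lemma laurent_polys_linear:
  assumes "qlinear f" "p \<in> laurent_polys" "\<And>n i j. f (mon n i j) \<in> laurent_polys"
  shows "f p \<in> laurent_polys"
  using assms(2) unfolding laurent_polys_def
  by (rule qlinear_span[OF assms(1)]) (use assms(3) in \<open>auto simp: laurent_polys_def\<close>)

lemma laurent_polys_mult:
  assumes "p \<in> laurent_polys" "q \<in> laurent_polys"
  shows "p * q \<in> laurent_polys"
proof -
  have "mon n i j * q \<in> laurent_polys" for n i j
    by (rule laurent_polys_linear[OF qlinear_mult assms(2)]) (simp add: mon_mult)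
  then have "q * p \<in> laurent_polys"
    by (intro laurent_polys_linear[OF qlinear_mult assms(1)]) (simp add: mult.commute)
  then show ?thesis by (simp add: mult.commute)
qed

lemma deriv_t_mon: "deriv_t (mon n i j) = qscale (of_nat n) (mon (n - 1) i j)"
  by (rule series_eqI) (auto simp: cf_mon)

lemma diag_mon: "diag w (mon n i j) = qscale (w i j) (mon n i j)"
  by (rule series_eqI) (auto simp: cf_mon)

lemma laurent_polys_deriv_t: "p \<in> laurent_polys \<Longrightarrow> deriv_t p \<in> laurent_polys"
  by (rule laurent_polys_linear[OF qlinear_deriv_t])
     (simp_all add: deriv_t_mon laurent_polys_scale)

lemma laurent_polys_diag: "p \<in> laurent_polys \<Longrightarrow> diag w p \<in> laurent_polys"
  by (rule laurent_polys_linear[OF qlinear_diag]) (simp_all add: diag_mon laurent_polys_scale)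

lemma bernstein_laurent_poly_mult:
  assumes "bernstein_filtration V" "p \<in> laurent_polys"
  shows "\<exists>d. \<forall>N. \<forall>v\<in>V N. p * v \<in> V (N + d)"
  using assms(2) unfolding laurent_polys_def
proof (induction p rule: Q.span_induct_alt)
  case base
  show ?case using bernstein_subspace[OF assms(1)] by (auto intro: Q.subspace_0)
next
  case (step c m p)
  obtain d where d: "\<And>N v. v \<in> V N \<Longrightarrow> p * v \<in> V (N + d)" using step by blast
  obtain n i j where m: "m = mon n i j" using step by blast
  define e where "e = d + (n + nat \<bar>i\<bar> + nat \<bar>j\<bar>)"
  have "(qscale c m + p) * v \<in> V (N + e)" if "v \<in> V N" for v N
  proof -
    have "mon n i j * v \<in> V (N + e)"
      by (rule bernstein_mono[OF assms(1) _ bernstein_mon[OF assms(1) that]]) (simp add: e_def)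
    moreover have "p * v \<in> V (N + e)"
      by (rule bernstein_mono[OF assms(1) _ d[OF that]]) (simp add: e_def)
    ultimately have "qscale c (mon n i j * v) + p * v \<in> V (N + e)"
      using bernstein_subspace[OF assms(1)] by (intro Q.subspace_add Q.subspace_scale)
    then show ?thesis by (simp add: m algebra_simps)
  qed
  then show ?case by blast
qed

lemma holonomic_1: "holonomic 1"
proof -
  define G where "G N = (\<lambda>(n, i, j). mon n i j) ` ({..N} \<times> {- int N..int N} \<times> {- int N..int N})" for N
  have G: "mon n i j \<in> G N" if "n \<le> N" "\<bar>i\<bar> \<le> int N" "\<bar>j\<bar> \<le> int N" for n i j N
    using that unfolding G_def by (intro image_eqI[of _ _ "(n, i, j)"]) auto
  have fin: "finite (G N)" for N unfolding G_def by simp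
  have "card (G N) \<le> (N + 1) * (2 * N + 1) ^ 2" for N
  proof -
    have "card (G N) \<le> card ({..N} \<times> {- int N..int N} \<times> {- int N..int N})"
      unfolding G_def by (rule card_image_le) simp
    also have "\<dots> = (N + 1) * (2 * N + 1) ^ 2"
      by (simp add: card_cartesian_product power2_eq_square nat_add_distrib nat_mult_distrib)
    finally show ?thesis .
  qed
  also have "(N + 1) * (2 * N + 1) ^ 2 \<le> (N + 1) * (2 * (N + 1)) ^ 2" for N :: nat
    by (intro mult_left_mono power_mono) auto
  also have "(N + 1) * (2 * (N + 1)) ^ 2 = 4 * (N + 1) ^ 3" for N :: nat
    by (simp add: power2_eq_square power3_eq_cube)
  finally have dim: "dim_le (Q.span (G N)) (4 * (N + 1) ^ 3)" for N
    using fin by (auto simp: dim_le_def)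
  have "f v \<in> Q.span (G (Suc N))" if f: "f \<in> weyl_ops" and v: "v \<in> Q.span (G N)" for f v N
  proof (rule qlinear_span[OF qlinear_weyl_ops[OF f] v])
    fix g assume "g \<in> G N"
    then obtain n i j where g: "g = mon n i j" "n \<le> N" "\<bar>i\<bar> \<le> int N" "\<bar>j\<bar> \<le> int N"
      by (auto simp: G_def)
    show "f g \<in> Q.span (G (Suc N))"
      using f g(2-) unfolding weyl_ops_def g(1)
      by (elim insertE emptyE; hypsubst; simp only: mon_mult deriv_t_mon diag_mon)
         ((intro Q.span_scale)?, rule Q.span_base, rule G; force)+
  qed
  then have "bernstein_filtration (\<lambda>N. Q.span (G N))"
    unfolding bernstein_filtration_def using dim by blast
  moreover have "1 \<in> Q.span (G 0)"
    using G[of 0 0 0 0] by (auto intro: Q.span_base)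
  ultimately show ?thesis unfolding holonomic_def by (intro exI[of _ "\<lambda>N. Q.span (G N)"]) simp
qed


lemma nat_cube_mono: "(a::nat) \<le> b \<Longrightarrow> a ^ 3 \<le> b ^ 3"
  by (rule power_mono) auto

lemma const_of_nat: "rat_const (of_nat n) = of_nat n"
  by (simp only: rat_const_def single_of_nat fps_of_nat)

lemma deriv_t_mult: "deriv_t (F * G) = deriv_t F * G + F * deriv_t G"
  by (simp add: deriv_t_def)

text \<open>
  The usual \<open>d(D\<^sup>n) = n D\<^sup>n\<^sup>-\<^sup>1 d(D)\<close>, multiplied by \<open>D\<close> to avoid the exponent \<open>n - 1\<close>.
\<close>

lemma derivation_power:
  fixes D :: "series"
  assumes "\<And>F G. d (F * G) = d F * G + F * d G"
  shows "D * d (D ^ n) = of_nat n * d D * D ^ n"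
proof (induction n)
  case 0
  have "d 1 = d 1 + d 1" using assms[of 1 1] by simp
  then show ?case by simp
next
  case (Suc n)
  have "D * d (D ^ Suc n) = d D * D ^ Suc n + D * (D * d (D ^ n))"
    by (simp add: assms algebra_simps)
  also have "\<dots> = of_nat (Suc n) * d D * D ^ Suc n"
    unfolding Suc by (simp add: algebra_simps)
  finally show ?case .
qed

text \<open>
  A new filtration allows one more factor \<open>D\<close> in the denominator at each level: its \<open>N\<close>-th member
  consists of the \<open>u\<close> with \<open>D\<^sup>N\<^sup>+\<^sup>1 u \<in> V (c (N+1))\<close>. As \<open>D \<noteq> 0\<close>, multiplication by \<open>D\<^sup>N\<^sup>+\<^sup>1\<close> is injective, so
  the dimension is at most that of \<open>V (c (N+1))\<close>. A derivation \<open>d\<close> raises the level by one since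
  \<open>D\<^sup>N\<^sup>+\<^sup>2 du = D d(D\<^sup>N\<^sup>+\<^sup>1 u) - (N+1) dD D\<^sup>N\<^sup>+\<^sup>1 u\<close>.
\<close>

lemma holonomic_quotient:
  assumes F: "holonomic F" and D: "D \<in> laurent_polys" "D \<noteq> 0" and P: "P \<in> laurent_polys"
    and E: "D * E = P * F"
  shows "holonomic E"
proof -
  obtain V where V: "bernstein_filtration V" "F \<in> V 0" using F by (auto simp: holonomic_def)
  have "\<forall>p\<in>{D, P, deriv_t D, diag (\<lambda>a b. of_int a) D, diag (\<lambda>a b. of_int b) D}.
      \<exists>d. \<forall>N. \<forall>v\<in>V N. p * v \<in> V (N + d)"
    using D P by (auto intro!: bernstein_laurent_poly_mult[OF V(1)]
      laurent_polys_deriv_t laurent_polys_diag)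
  then obtain e where e: "\<And>p N v. p \<in> {D, P, deriv_t D, diag (\<lambda>a b. of_int a) D,
      diag (\<lambda>a b. of_int b) D} \<Longrightarrow> v \<in> V N \<Longrightarrow> p * v \<in> V (N + e p)"
    by metis
  \<comment> \<open>The stride \<open>c\<close> leaves room for one operator and one multiplication by any of the five polynomials.\<close>
  define c where "c = Suc (e D + e P + e (deriv_t D) + e (diag (\<lambda>a b. of_int a) D)
    + e (diag (\<lambda>a b. of_int b) D))"
  define U where "U N = {u. D ^ (N + 1) * u \<in> V (c * (N + 1))}" for N
  note V_add = Q.subspace_add[OF bernstein_subspace[OF V(1)]]
    and V_diff = Q.subspace_diff[OF bernstein_subspace[OF V(1)]]
    and V_scale = Q.subspace_scale[OF bernstein_subspace[OF V(1)]]
  have times: "p * v \<in> V (Suc k + (c - 1))"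
    if "v \<in> V k" "p \<in> {D, P, deriv_t D, diag (\<lambda>a b. of_int a) D, diag (\<lambda>a b. of_int b) D}" for p v k
    using that by (intro bernstein_mono[OF V(1) _ e[OF that(2,1)]]) (auto simp: c_def)
  have cs: "c * (Suc N + 1) = Suc (c * (N + 1)) + (c - 1)" for N
    by (simp add: c_def algebra_simps)
  have sub: "Q.subspace (U N)" for N
    unfolding U_def Q.subspace_def using Q.subspace_0[OF bernstein_subspace[OF V(1)]]
    by (auto simp: distrib_left mult.left_commute[of _ "rat_const _"] intro: V_add V_scale)
  have inj: "inj ((*) (D ^ (N + 1)))" for N
    using D(2) by (auto simp: inj_def)
  obtain C where C: "\<And>N. dim_le (V N) (C * (N + 1) ^ 3)"
    using bernstein_dim[OF V(1)] by blast
  have dim: "dim_le (U N) (C * (c + 1) ^ 3 * (N + 1) ^ 3)" for N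
  proof -
    have "dim_le (U N) (C * (c * (N + 1) + 1) ^ 3)"
      by (rule dim_le_injective_image[OF sub qlinear_mult inj _ C]) (auto simp: U_def)
    moreover have "C * (c * (N + 1) + 1) ^ 3 \<le> C * ((c + 1) * (N + 1)) ^ 3"
      by (intro mult_left_mono nat_cube_mono) (auto simp: algebra_simps)
    ultimately show ?thesis
      unfolding dim_le_def power_mult_distrib mult.assoc[symmetric] by (meson le_trans)
  qed
  have derivation: "d u \<in> U (Suc N)"
    if d: "d \<in> weyl_ops" "\<And>F G. d (F * G) = d F * G + F * d G"
      "d D \<in> {D, P, deriv_t D, diag (\<lambda>a b. of_int a) D, diag (\<lambda>a b. of_int b) D}"
      and u: "u \<in> U N" for d u N
  proof -
    define w where "w = D ^ (N + 1) * u"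
    have w: "w \<in> V (c * (N + 1))" using u by (simp add: U_def w_def)
    have "D * d w = of_nat (N + 1) * d D * w + D ^ (N + 2) * d u"
      unfolding w_def d(2) distrib_left mult.assoc[symmetric] derivation_power[OF d(2)]
      by simp
    then have "D ^ (N + 2) * d u = D * d w - rat_const (of_nat (N + 1)) * (d D * w)"
      unfolding const_of_nat by (simp add: algebra_simps)
    moreover have "D * d w \<in> V (Suc (c * (N + 1)) + e D)"
      using e[of D] bernstein_op[OF V(1) d(1) w] by blast
    then have "D * d w \<in> V (Suc (c * (N + 1)) + (c - 1))"
      by (rule bernstein_mono[OF V(1), rotated]) (simp add: c_def)
    moreover have "d D * w \<in> V (Suc (c * (N + 1)) + (c - 1))"
      by (rule times[OF w d(3)])
    ultimately show ?thesis
      unfolding U_def mem_Collect_eq cs by (simp add: V_diff V_scale)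
  qed
  have mult: "m * u \<in> U (Suc N)" if "(*) m \<in> weyl_ops" "u \<in> U N" for m u N
  proof -
    have "m * (D ^ (N + 1) * u) \<in> V (Suc (c * (N + 1)))"
      using bernstein_op[OF V(1) that(1)] that(2) by (simp add: U_def)
    then have "D * (m * (D ^ (N + 1) * u)) \<in> V (Suc (c * (N + 1)) + e D)"
      using e[of D] by blast
    then have "D * (m * (D ^ (N + 1) * u)) \<in> V (Suc (c * (N + 1)) + (c - 1))"
      by (rule bernstein_mono[OF V(1), rotated]) (simp add: c_def)
    then show ?thesis unfolding U_def mem_Collect_eq cs by (simp add: mult_ac)
  qed
  have ident: "u \<in> U (Suc N)" if "u \<in> U N" for u N
    using times[of "D ^ (N + 1) * u" "c * (N + 1)" D] that
    unfolding U_def mem_Collect_eq cs by (simp add: mult_ac)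
  have "f u \<in> U (Suc N)" if f: "f \<in> weyl_ops" and u: "u \<in> U N" for f u N
  proof -
    have "f \<in> {\<lambda>F. F, (*) (mon 1 0 0), (*) (mon 0 1 0), (*) (mon 0 (-1) 0), (*) (mon 0 0 1),
      (*) (mon 0 0 (-1)), deriv_t, diag (\<lambda>a b. of_int a), diag (\<lambda>a b. of_int b)}"
      using f by (simp only: weyl_ops_def)
    then show ?thesis
      by (elim insertE emptyE; hypsubst)
         (rule ident mult derivation u weyl_ops_intros deriv_t_mult diag_mult of_int_add
           insertI1 insertI2)+
  qed
  then have "bernstein_filtration U" using sub dim unfolding bernstein_filtration_def by blast
  moreover have "E \<in> U 0"
    using times[of F 0 P] V(2) E by (simp add: U_def c_def)
  ultimately show ?thesis unfolding holonomic_def by blast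
qed


lemma bernstein_deriv:
  assumes "bernstein_filtration V" "v \<in> V N"
  shows "deriv_t v \<in> V (N + 1)" "deriv_x v \<in> V (N + 2)" "deriv_y v \<in> V (N + 2)"
  using bernstein_op[OF assms(1) weyl_ops_intros(2) assms(2)]
    bernstein_op[OF assms(1) weyl_ops_intros(5) bernstein_op[OF assms(1) weyl_ops_intros(8) assms(2)]]
    bernstein_op[OF assms(1) weyl_ops_intros(7) bernstein_op[OF assms(1) weyl_ops_intros(9) assms(2)]]
  by (simp_all add: deriv_x_eq deriv_y_eq)

lemma bernstein_deriv_funpow:
  assumes "bernstein_filtration V" "\<And>v N. v \<in> V N \<Longrightarrow> d v \<in> V (N + e)" "v \<in> V N"
  shows "(d ^^ k) v \<in> V (N + k * e)"
proof (induction k)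
  case (Suc k)
  show ?case using assms(2)[OF Suc] by (simp add: algebra_simps)
qed (use assms(3) in simp)

section \<open>Holonomic series are D-finite\<close>

lemma to_fract_sum: "to_fract (sum f A) = (\<Sum>i\<in>A. to_fract (f i))"
  by (induction A rule: infinite_finite_induct) simp_all

lemma to_fract_power: "to_fract (a ^ n) = to_fract a ^ n"
  by (induction n) simp_all

lemma ratfuns_0: "0 \<in> ratfuns"
  using ratfuns.add[OF ratfuns.one ratfuns.uminus[OF ratfuns.one]] by simp

lemma ratfuns_sum: "(\<And>i. i \<in> A \<Longrightarrow> f i \<in> ratfuns) \<Longrightarrow> sum f A \<in> ratfuns"
  by (induction A rule: infinite_finite_induct) (auto intro: ratfuns_0 ratfuns.add)

lemma ratfuns_power: "f \<in> ratfuns \<Longrightarrow> f ^ n \<in> ratfuns"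
  by (induction n) (auto intro: ratfuns.one ratfuns.mult)

lemma ratfuns_of_nat: "of_nat n \<in> ratfuns"
  by (induction n) (auto intro: ratfuns_0 ratfuns.add ratfuns.one)

lemma ratfuns_const: "to_fract (rat_const c) \<in> ratfuns"
proof -
  have "to_fract (of_nat n :: series) = of_nat n" for n
    by (induction n) simp_all
  then have nat: "to_fract (rat_const (of_nat n)) \<in> ratfuns" for n
    using ratfuns_of_nat[of n] by (simp add: const_of_nat)
  have int: "to_fract (rat_const (of_int k)) \<in> ratfuns" for k
  proof (cases k)
    case (nonneg n)
    then show ?thesis using nat by simp
  next
    case (neg n)
    then have "rat_const (of_int k) = - rat_const (of_nat (Suc n))"
      by (intro series_eqI) (simp add: cf_def rat_const_def single_uminus del: of_nat_Suc)
    then show ?thesis using nat[of "Suc n"] ratfuns.uminus by simp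
  qed
  obtain a b where c: "c = of_int a / of_int b" "b > 0"
    using quotient_of_div[of c] quotient_of_denom_pos[of c] by (metis surj_pair)
  have "to_fract (rat_const (of_int b)) * to_fract (rat_const c) = to_fract (rat_const (of_int a))"
    using c(2) by (simp add: c(1) to_fract_mult[symmetric] const_mult[symmetric] del: to_fract_mult)
  moreover have "to_fract (rat_const (of_int b)) \<noteq> 0"
    using c(2) by (simp add: rat_const_def fps_eq_iff)
  ultimately have "to_fract (rat_const c) = to_fract (rat_const (of_int a)) * inverse (to_fract (rat_const (of_int b)))"
    by (simp add: field_simps)
  then show ?thesis using int by (auto intro: ratfuns.mult ratfuns.inverse)
qed

lemma mon_power: "mon n (int i) (int j) = mon 1 0 0 ^ n * mon 0 1 0 ^ i * mon 0 0 1 ^ j"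
proof -
  have "mon a b c ^ k = mon (k * a) (int k * b) (int k * c)" for a b c k
    by (induction k) (simp_all add: mon_mult distrib_right)
  then show ?thesis by (simp add: mon_mult)
qed

lemma mon_variables: "vt = to_fract (mon 1 0 0)" "vx = to_fract (mon 0 1 0)" "vy = to_fract (mon 0 0 1)"
  by (simp_all add: vt_def vx_def vy_def mon_def xy_mono_0_0)

lemma ratfuns_mon: "to_fract (mon n (int i) (int j)) \<in> ratfuns"
  by (simp add: mon_power to_fract_power mon_variables[symmetric] ratfuns.intros ratfuns_power
    del: One_nat_def)

text \<open>
  A family, rather than a set, so that coinciding members count as a relation.
\<close>

lemma linear_relation_exists:
  assumes "finite I" "finite T" "f ` I \<subseteq> Q.span T" "card T < card I"
  shows "\<exists>q. (\<exists>i\<in>I. q i \<noteq> 0) \<and> (\<Sum>i\<in>I. qscale (q i) (f i)) = 0"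
proof (cases "inj_on f I")
  case False
  then obtain i j where ij: "i \<in> I" "j \<in> I" "i \<noteq> j" "f i = f j"
    by (auto simp: inj_on_def)
  define q :: "'a \<Rightarrow> rat" where "q = (\<lambda>k. of_bool (k = i) - of_bool (k = j))"
  have "qscale (q k) (f k) = (if k = i then f i else 0) - (if k = j then f j else 0)" for k
    using ij by (auto simp: q_def)
  then have "(\<Sum>k\<in>I. qscale (q k) (f k)) = 0"
    using assms(1) ij by (simp add: sum_subtractf sum.delta)
  moreover have "q i \<noteq> 0" using ij by (simp add: q_def)
  ultimately show ?thesis using ij(1) by blast
next
  case True
  then have "card (f ` I) = card I" by (rule card_image)
  then have "Q.dependent (f ` I)"
    using Q.independent_span_bound[OF assms(2) _ assms(3)] assms(4) by linarith
  then obtain u v where u: "v \<in> f ` I" "u v \<noteq> 0" "(\<Sum>w\<in>f ` I. qscale (u w) w) = 0"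
    using Q.dependent_finite[of "f ` I"] assms(1) by blast
  then show ?thesis
    using True by (intro exI[of _ "u \<circ> f"]) (auto simp: sum.reindex)
qed

definition ratfun_independent :: "series fract set \<Rightarrow> bool" where
  "ratfun_independent B \<longleftrightarrow> (\<forall>c. (\<forall>b\<in>B. c b \<in> ratfuns) \<and> (\<Sum>b\<in>B. c b * b) = 0
    \<longrightarrow> (\<forall>b\<in>B. c b = 0))"

text \<open>
  The rational functions are a set and not a type, so the exchange argument of linear algebra is carried
  out by hand: in a relation on \<open>insert p B\<close> the coefficient of \<open>p\<close> cannot vanish.
\<close>

lemma in_ratfun_span_if_dependent_insert:
  assumes "finite B" "ratfun_independent B" "\<not> ratfun_independent (insert p B)"
  shows "\<exists>c. (\<forall>b\<in>B. c b \<in> ratfuns) \<and> p = (\<Sum>b\<in>B. c b * b)"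
proof -
  have "p \<notin> B" using assms(2,3) by (auto simp: insert_absorb)
  obtain c where c: "\<forall>b\<in>insert p B. c b \<in> ratfuns" "(\<Sum>b\<in>insert p B. c b * b) = 0"
    and c0: "\<not> (\<forall>b\<in>insert p B. c b = 0)"
    using assms(3) unfolding ratfun_independent_def by blast
  have sum: "c p * p + (\<Sum>b\<in>B. c b * b) = 0"
    using c(2) unfolding sum.insert[OF assms(1) \<open>p \<notin> B\<close>] .
  have "c p \<noteq> 0"
  proof
    assume "c p = 0"
    then have "(\<Sum>b\<in>B. c b * b) = 0" using sum by simp
    moreover have "\<forall>b\<in>B. c b \<in> ratfuns" using c(1) by simp
    ultimately have "\<forall>b\<in>B. c b = 0"
      using assms(2)[unfolded ratfun_independent_def, THEN spec, of c] by (elim mp) (rule conjI)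
    then show False using c0 \<open>c p = 0\<close> by simp
  qed
  have "c p * p = - (\<Sum>b\<in>B. c b * b)" using sum by (simp only: eq_neg_iff_add_eq_0)
  then have "- inverse (c p) * (\<Sum>b\<in>B. c b * b) = inverse (c p) * (c p * p)" by simp
  also have "\<dots> = p" using \<open>c p \<noteq> 0\<close> by (simp add: mult.assoc[symmetric])
  finally have "p = (\<Sum>b\<in>B. (- inverse (c p) * c b) * b)"
    unfolding sum_distrib_left mult.assoc by (rule sym)
  moreover have "\<forall>b\<in>B. - inverse (c p) * c b \<in> ratfuns"
    using c(1) by (simp add: ratfuns.mult ratfuns.uminus ratfuns.inverse)
  ultimately show ?thesis by (intro exI conjI)
qed

text \<open>
  An independent subset of maximal size spans.
\<close>

lemma finite_ratfun_span:
  assumes bound: "\<And>B. finite B \<Longrightarrow> B \<subseteq> D \<Longrightarrow> ratfun_independent B \<Longrightarrow> card B \<le> m"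
  shows "\<exists>B. finite B \<and> B \<subseteq> D \<and> ratfun_span D = ratfun_span B"
proof -
  let ?P = "\<lambda>B. finite B \<and> B \<subseteq> D \<and> ratfun_independent B"
  have "?P {}" by (simp add: ratfun_independent_def)
  moreover have "\<forall>B. ?P B \<longrightarrow> card B < Suc m" using bound by (simp add: less_Suc_eq_le)
  ultimately have "\<exists>B. ?P B \<and> (\<forall>A. ?P A \<longrightarrow> card A \<le> card B)"
    by (rule ex_has_greatest_nat)
  then obtain B where PB: "?P B" and max: "\<forall>A. ?P A \<longrightarrow> card A \<le> card B"
    by (elim exE conjE) (rule that; simp)
  have B: "finite B" "B \<subseteq> D" "ratfun_independent B" using PB by simp_all
  have "\<exists>c. (\<forall>b\<in>B. c b \<in> ratfuns) \<and> p = (\<Sum>b\<in>B. c b * b)" if p: "p \<in> D" for p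
  proof (cases "p \<in> B")
    case True
    have "(\<Sum>b\<in>B. (if b = p then 1 else 0) * b) = (\<Sum>b\<in>B. if b = p then b else 0)"
      by (rule sum.cong) simp_all
    then have "p = (\<Sum>b\<in>B. (if b = p then 1 else 0) * b)"
      using True B(1) by simp
    moreover have "\<forall>b\<in>B. (if b = p then 1 else 0) \<in> ratfuns"
      by (simp add: ratfuns_0 ratfuns.one)
    ultimately show ?thesis by (intro exI conjI)
  next
    case False
    have "\<not> ratfun_independent (insert p B)"
    proof
      assume "ratfun_independent (insert p B)"
      then have "?P (insert p B)" using p B(1,2) by simp
      then have "card (insert p B) \<le> card B" by (rule max[THEN spec, THEN mp])
      then show False using B(1) False by simp
    qed
    then show ?thesis by (rule in_ratfun_span_if_dependent_insert[OF B(1,3)])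
  qed
  then have "\<forall>p\<in>D. \<exists>c. (\<forall>b\<in>B. c b \<in> ratfuns) \<and> p = (\<Sum>b\<in>B. c b * b)" by simp
  from bchoice[OF this] obtain d where
    d: "\<forall>p\<in>D. (\<forall>b\<in>B. d p b \<in> ratfuns) \<and> p = (\<Sum>b\<in>B. d p b * b)" ..
  have "ratfun_span D \<subseteq> ratfun_span B"
  proof
    fix x assume "x \<in> ratfun_span D"
    then obtain A c where x: "x = (\<Sum>p\<in>A. c p * p)"
      and A: "finite A" "A \<subseteq> D" "\<forall>p\<in>A. c p \<in> ratfuns"
      unfolding ratfun_span_def by blast
    have "x = (\<Sum>p\<in>A. c p * (\<Sum>b\<in>B. d p b * b))"
      unfolding x by (intro sum.cong refl arg_cong2[of _ _ _ _ "(*)"]) (use d A(2) in blast)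
    also have "\<dots> = (\<Sum>p\<in>A. \<Sum>b\<in>B. c p * d p b * b)"
      by (simp only: sum_distrib_left mult.assoc)
    also have "\<dots> = (\<Sum>b\<in>B. (\<Sum>p\<in>A. c p * d p b) * b)"
      unfolding sum_distrib_right by (rule sum.swap)
    finally have "x = (\<Sum>b\<in>B. (\<Sum>p\<in>A. c p * d p b) * b)" .
    moreover have "(\<Sum>p\<in>A. c p * d p b) \<in> ratfuns" if "b \<in> B" for b
      by (intro ratfuns_sum ratfuns.mult) (use A d that in blast)+
    ultimately show "x \<in> ratfun_span B"
      unfolding ratfun_span_def mem_Collect_eq using B(1)
      by (intro exI[of _ B] exI[of _ "\<lambda>b. \<Sum>p\<in>A. c p * d p b"]) simp
  qed
  moreover have "ratfun_span B \<subseteq> ratfun_span D"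
    using B(2) unfolding ratfun_span_def by blast
  ultimately show ?thesis using B(1,2) by blast
qed

text \<open>
  If each \<open>V N\<close> has dimension at most \<open>C (N+1)\<^sup>3\<close>, there are no more than \<open>64 C\<close> independent partial derivatives.
  Suppose that those in \<open>B\<close> lie in \<open>V r\<close>. Multiplied by the monomials with exponents at most \<open>r\<close> they give
  \<open>(r+1)\<^sup>3 card B\<close> elements of \<open>V (4r)\<close>, whose dimension is at most \<open>C (4r+1)\<^sup>3 \<le> 64 C (r+1)\<^sup>3\<close>. If
  \<open>card B > 64 C\<close>, then they satisfy a rational linear relation, and collecting the terms of each
  derivative gives a relation with polynomial coefficients that do not all vanish.
\<close>

theorem D_finite_if_holonomic:
  assumes "holonomic F"
  shows "D_finite F"
proof -
  obtain V where V: "bernstein_filtration V" "F \<in> V 0" using assms by (auto simp: holonomic_def)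
  obtain C where C: "\<And>N. dim_le (V N) (C * (N + 1) ^ 3)"
    using bernstein_dim[OF V(1)] by blast
  let ?D = "partial_derivs F"
  have D: "\<exists>q N. p = to_fract q \<and> q \<in> V N" if p: "p \<in> ?D" for p
  proof -
    obtain i j k where ijk: "p = to_fract ((deriv_t ^^ i) ((deriv_x ^^ j) ((deriv_y ^^ k) F)))"
      using p unfolding partial_derivs_def by blast
    note funpow = bernstein_deriv_funpow[OF V(1)]
    have "(deriv_t ^^ i) ((deriv_x ^^ j) ((deriv_y ^^ k) F)) \<in> V (0 + k * 2 + j * 2 + i * 1)"
      by (intro funpow bernstein_deriv[OF V(1)] V(2))
    then show ?thesis using ijk by blast
  qed
  have bound: "card B \<le> 64 * C" if B: "finite B" "B \<subseteq> ?D" "ratfun_independent B" for B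
  proof (rule ccontr)
    assume "\<not> card B \<le> 64 * C"
    have "\<forall>b\<in>B. \<exists>q N. b = to_fract q \<and> q \<in> V N" using B(2) D by blast
    then obtain h d where h: "\<And>b. b \<in> B \<Longrightarrow> b = to_fract (h b)" "\<And>b. b \<in> B \<Longrightarrow> h b \<in> V (d b)"
      by metis
    define r where "r = sum d B"
    have hr: "h b \<in> V r" if "b \<in> B" for b
      using bernstein_mono[OF V(1) _ h(2)[OF that], of r] member_le_sum[OF that, of d] B(1)
      by (simp add: r_def)
    define I where "I = ({..r} \<times> {..r} \<times> {..r}) \<times> B"
    define f where "f = (\<lambda>((i, j, k), b). mon i (int j) (int k) * h b)"
    have "finite I" using B(1) by (simp add: I_def)
    obtain T where T: "finite T" "card T \<le> C * (4 * r + 1) ^ 3" "V (4 * r) \<subseteq> Q.span T"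
      using C[of "4 * r"] by (auto simp: dim_le_def)
    have "f x \<in> Q.span T" if xI: "x \<in> I" for x
    proof -
      obtain i j k b where x: "x = ((i, j, k), b)" "i \<le> r" "j \<le> r" "k \<le> r" "b \<in> B"
        using xI unfolding I_def by blast
      have "f x \<in> V (r + i + nat \<bar>int j\<bar> + nat \<bar>int k\<bar>)"
        unfolding f_def x(1) prod.case by (rule bernstein_mon[OF V(1) hr[OF x(5)]])
      then have "f x \<in> V (4 * r)"
        by (rule bernstein_mono[OF V(1), rotated]) (use x in simp)
      then show ?thesis using T(3) by blast
    qed
    then have "f ` I \<subseteq> Q.span T" by blast
    moreover have "card T < card I"
    proof -
      have "card T \<le> C * (4 * r + 1) ^ 3" by (rule T(2))
      also have "\<dots> \<le> C * (4 * (r + 1)) ^ 3"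
        by (intro mult_left_mono nat_cube_mono) auto
      also have "\<dots> = 64 * C * (r + 1) ^ 3" unfolding power_mult_distrib by simp
      also have "\<dots> < card B * (r + 1) ^ 3"
        using \<open>\<not> card B \<le> 64 * C\<close> by (intro mult_strict_right_mono) auto
      also have "\<dots> = card I" by (simp add: I_def card_cartesian_product power3_eq_cube)
      finally show ?thesis .
    qed
    ultimately obtain q where q: "\<exists>x\<in>I. q x \<noteq> 0" "(\<Sum>x\<in>I. qscale (q x) (f x)) = 0"
      using linear_relation_exists[OF \<open>finite I\<close> T(1), of f] by blast
    define p where "p b = (\<Sum>(i, j, k)\<in>{..r} \<times> {..r} \<times> {..r}.
      qscale (q ((i, j, k), b)) (mon i (int j) (int k)))" for b
    have "(\<Sum>x\<in>I. qscale (q x) (f x)) =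
        (\<Sum>y\<in>{..r} \<times> {..r} \<times> {..r}. \<Sum>b\<in>B. qscale (q (y, b)) (f (y, b)))"
      unfolding I_def by (simp add: sum.cartesian_product)
    also have "\<dots> = (\<Sum>b\<in>B. p b * h b)"
      unfolding p_def by (subst sum.swap)
        (simp add: f_def sum_distrib_right case_prod_unfold mult.assoc)
    finally have "to_fract (\<Sum>b\<in>B. p b * h b) = 0" using q(2) by simp
    then have "(\<Sum>b\<in>B. to_fract (p b) * b) = 0"
      using h(1) by (simp add: to_fract_sum cong: sum.cong)
    moreover have "to_fract (p b) \<in> ratfuns" for b
      unfolding p_def to_fract_sum case_prod_unfold to_fract_mult
      by (intro ratfuns_sum ratfuns.mult ratfuns_const ratfuns_mon)
    ultimately have p0: "\<forall>b\<in>B. p b = 0"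
      using B(3)[unfolded ratfun_independent_def, THEN spec, of "\<lambda>b. to_fract (p b)"]
      unfolding to_fract_eq_0_iff by blast
    obtain i j k b where x: "i \<le> r" "j \<le> r" "k \<le> r" "b \<in> B" "q ((i, j, k), b) \<noteq> 0"
      using q(1) by (auto simp: I_def)
    have "cf (p b) i (int j) (int k) =
        (\<Sum>y\<in>{..r} \<times> {..r} \<times> {..r}. if y = (i, j, k) then q (y, b) else 0)"
      unfolding p_def cf_sum by (rule sum.cong) (auto simp: cf_mon split: if_splits)
    also have "\<dots> = q ((i, j, k), b)" using x by simp
    finally show False using p0 x by simp
  qed
  then show ?thesis unfolding D_finite_def by (rule finite_ratfun_span)
qed


section \<open>Positive parts of holonomic series\<close>

lemma dim_le_Un_image:
  assumes "dim_le V m" "dim_le W n" "qlinear f" "qlinear g" "U \<subseteq> Q.span (f ` V \<union> g ` W)"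
  shows "dim_le U (m + n)"
proof -
  obtain S T where S: "finite S" "card S \<le> m" "V \<subseteq> Q.span S"
    and T: "finite T" "card T \<le> n" "W \<subseteq> Q.span T"
    using assms(1,2) by (auto simp: dim_le_def)
  have "card (f ` S \<union> g ` T) \<le> card S + card T"
    using card_Un_le[of "f ` S" "g ` T"] card_image_le[OF S(1), of f] card_image_le[OF T(1), of g]
    by linarith
  moreover have "f v \<in> Q.span (f ` S \<union> g ` T)" if "v \<in> V" for v
    using that S(3) by (intro qlinear_span[OF assms(3), of v S]) (auto intro: Q.span_base)
  moreover have "g w \<in> Q.span (f ` S \<union> g ` T)" if "w \<in> W" for w
    using that T(3) by (intro qlinear_span[OF assms(4), of w T]) (auto intro: Q.span_base)
  ultimately have "Q.span (f ` V \<union> g ` W) \<subseteq> Q.span (f ` S \<union> g ` T)"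
    by (intro Q.span_minimal) auto
  then show ?thesis
    unfolding dim_le_def using S T assms(5) \<open>card (f ` S \<union> g ` T) \<le> card S + card T\<close>
    by (intro exI[of _ "f ` S \<union> g ` T"]) auto
qed

text \<open>
  The vector \<open>(e1, e2)\<close> selects \<open>x\<close> or \<open>y\<close> as the variable \<open>z\<close>, and \<open>l a b\<close> is the exponent of \<open>z\<close> in \<open>x\<^sup>a y\<^sup>b\<close>.
  Positive parts commute with all the operators except the multiplications by \<open>z\<close> and \<open>1/z\<close>, which
  move a term between the exponents \<open>0\<close> and \<open>1\<close>. So the new filtration \<open>W N\<close> is spanned by the positive parts of
  \<open>V N\<close> together with the boundary terms \<open>z\<^sup>k [z\<^sup>0]v\<close> for \<open>v \<in> V N\<close> and \<open>\<bar>k\<bar> \<le> N\<close>. Counting these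
  naively gives \<open>N\<^sup>4\<close>. The gain comes from Lagrange interpolation: the product of
  the operators \<open>z \<partial>/\<partial>z - i\<close> over \<open>0 < \<bar>i\<bar> \<le> 2N\<close> deletes from \<open>v\<close> the exponents \<open>i\<close> of \<open>z\<close> and keeps a
  nonzero multiple of the constant term. After multiplication by \<open>z\<^sup>k\<close> the result agrees, in the window
  of exponents from \<open>-N\<close> to \<open>N\<close>, with that multiple of \<open>z\<^sup>k [z\<^sup>0]v\<close>. So all boundary terms lie in
  the truncation to this window of \<open>V (6N)\<close>, which has dimension \<open>O(N\<^sup>3)\<close>.
\<close>

lemma holonomic_positive_part:
  fixes e1 e2 :: int
  assumes e: "e1 = 1 \<and> e2 = 0 \<or> e1 = 0 \<and> e2 = 1" and F: "holonomic F"
  shows "holonomic (diag (\<lambda>a b. of_bool (0 < e1 * a + e2 * b)) F)"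
proof -
  obtain V where V: "bernstein_filtration V" "F \<in> V 0" using F by (auto simp: holonomic_def)
  define l where "l a b = e1 * a + e2 * b" for a b
  \<comment> \<open>The primed objects belong to the other variable.\<close>
  define l' where "l' a b = e2 * a + e1 * b" for a b
  define z where "z k = mon 0 (k * e1) (k * e2)" for k
  define z' where "z' k = mon 0 (k * e2) (k * e1)" for k
  have [simp]: "l (a - k * e1) (b - k * e2) = l a b - k" "l' (a - k * e1) (b - k * e2) = l' a b"
    "l (a - k * e2) (b - k * e1) = l a b" "l (a - e1) (b - e2) = l a b - 1"
    "l (a + e1) (b + e2) = l a b + 1" "l (a - e2) (b - e1) = l a b"
    "l (a + e2) (b + e1) = l a b" for a b k
    using e by (auto simp: l_def l'_def)
  define pos where "pos = diag (\<lambda>a b. of_bool (0 < l a b))"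
  define zero where "zero = diag (\<lambda>a b. of_bool (l a b = 0))"
  define \<theta> where "\<theta> = diag (\<lambda>a b. of_int (l a b))"
  define \<theta>' where "\<theta>' = diag (\<lambda>a b. of_int (l' a b))"
  have ops: "weyl_ops = {\<lambda>F. F, (*) (mon 1 0 0), deriv_t, (*) (z 1), (*) (z (-1)),
      (*) (z' 1), (*) (z' (-1)), \<theta>, \<theta>'}"
    using e unfolding weyl_ops_def z_def z'_def \<theta>_def \<theta>'_def l_def l'_def
    by (elim disjE conjE; hypsubst; simp only: mult_1 mult_1_right mult_zero_left mult_zero_right
      add_0 add_0_right; blast)
  note V_op = bernstein_op[OF V(1), unfolded ops]
  define G where "G N = pos ` V N \<union> {z k * zero v | k v. \<bar>k\<bar> \<le> int N \<and> v \<in> V N}" for N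
  define W where "W N = Q.span (G N)" for N
  have pos_W: "pos v \<in> W N" if "v \<in> V N" for v N
    using that by (auto simp: W_def G_def intro!: Q.span_base)
  have zero_W: "z k * zero v \<in> W N" if "v \<in> V N" "\<bar>k\<bar> \<le> int N" for k v N
    using that by (auto simp: W_def G_def intro!: Q.span_base)
  have pos_op: "f (pos v) \<in> W (Suc N)" if v: "v \<in> V N" and f: "f \<in> weyl_ops" for f v N
  proof -
    have fv: "f v \<in> V (Suc N)" by (rule bernstein_op[OF V(1) f v])
    have commute: ?thesis if "f (pos v) = pos (f v)"
      unfolding that by (rule pos_W[OF fv])
    have up: ?thesis if "f = (*) (z 1)"
    proof -
      have "f (pos v) = pos (f v) - z 1 * zero v"
        unfolding that by (rule series_eqI) (auto simp: pos_def zero_def z_def cf_mon_mult)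
      moreover have "z 1 * zero v \<in> W (Suc N)"
        by (rule zero_W[OF bernstein_mono[OF V(1) _ v]]) auto
      ultimately show ?thesis
        using pos_W[OF fv] unfolding W_def by (simp add: Q.span_diff)
    qed
    have down: ?thesis if "f = (*) (z (-1))"
    proof -
      have "f (pos v) = pos (f v) + z 0 * zero (f v)"
        unfolding that by (rule series_eqI) (auto simp: pos_def zero_def z_def cf_mon_mult)
      then show ?thesis
        using pos_W[OF fv] zero_W[OF fv, of 0] unfolding W_def by (simp add: Q.span_add)
    qed
    consider "f = (*) (z 1)" | "f = (*) (z (-1))" |
      "f \<in> {\<lambda>F. F, (*) (mon 1 0 0), deriv_t, (*) (z' 1), (*) (z' (-1)), \<theta>, \<theta>'}"
      using f[unfolded ops] by blast
    then show ?thesis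
    proof cases
      case 3
      then have "f (pos v) = pos (f v)"
        by (elim insertE emptyE; hypsubst; intro series_eqI)
           (auto simp: pos_def \<theta>_def \<theta>'_def z'_def cf_mon_mult)
      then show ?thesis by (rule commute)
    qed (rule up down; assumption)+
  qed
  have zero_op: "f (z k * zero v) \<in> W (Suc N)"
    if v: "v \<in> V N" and k: "\<bar>k\<bar> \<le> int N" and f: "f \<in> weyl_ops" for f v k N
  proof -
    have fv: "f v \<in> V (Suc N)" by (rule bernstein_op[OF V(1) f v])
    have v': "v \<in> V (Suc N)" by (rule bernstein_mono[OF V(1) _ v]) simp
    have commute: ?thesis if "f (z k * zero v) = z k * zero (f v)"
      unfolding that by (rule zero_W[OF fv]) (use k in simp)
    have shift: ?thesis if "f = (*) (z s)" "\<bar>s\<bar> \<le> 1" for s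
    proof -
      have "f (z k * zero v) = z (s + k) * zero v"
        unfolding that(1) z_def by (simp add: mult.assoc[symmetric] mon_mult distrib_right)
      then show ?thesis using zero_W[OF v', of "s + k"] k that(2) by simp
    qed
    have theta: ?thesis if "f = \<theta>"
    proof -
      have "f (z k * zero v) = qscale (of_int k) (z k * zero v)"
        unfolding that by (rule series_eqI) (auto simp: \<theta>_def zero_def z_def cf_mon_mult)
      then show ?thesis using zero_W[OF v', of k] k unfolding W_def by (simp add: Q.span_scale)
    qed
    have transverse: ?thesis if "f = (*) (z' s)" for s
    proof (rule commute)
      have "z' s * zero v = zero (z' s * v)"
        by (rule series_eqI) (auto simp: zero_def z'_def cf_mon_mult)
      then show "f (z k * zero v) = z k * zero (f v)"
        unfolding that by (metis mult.left_commute)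
    qed
    consider "f = (*) (z 1)" | "f = (*) (z (-1))" | "f = \<theta>" | "f = (*) (z' 1)" |
      "f = (*) (z' (-1))" | "f \<in> {\<lambda>F. F, (*) (mon 1 0 0), deriv_t, \<theta>'}"
      using f[unfolded ops] by blast
    then show ?thesis
    proof cases
      case 1
      then show ?thesis by (rule shift) simp
    next
      case 2
      then show ?thesis by (rule shift) simp
    next
      case 3
      then show ?thesis by (rule theta)
    next
      case 4
      then show ?thesis by (rule transverse)
    next
      case 5
      then show ?thesis by (rule transverse)
    next
      case 6
      then have "f (z k * zero v) = z k * zero (f v)"
        by (elim insertE emptyE; hypsubst; intro series_eqI)
           (auto simp: zero_def \<theta>'_def z_def cf_mon_mult)
      then show ?thesis by (rule commute)
    qed
  qed
  have op: "f w \<in> W (Suc N)" if f: "f \<in> weyl_ops" and w: "w \<in> W N" for f w N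
    using w pos_op[OF _ f] zero_op[OF _ _ f] unfolding W_def
    by (intro qlinear_span[OF qlinear_weyl_ops[OF f], of w "G N"]) (auto simp: G_def)
  obtain C where C: "\<And>N. dim_le (V N) (C * (N + 1) ^ 3)"
    using bernstein_dim[OF V(1)] by blast
  \<comment> \<open>The constant is \<open>1 + 6\<^sup>3\<close>: one copy of \<open>V N\<close> and one of \<open>V (6N)\<close>.\<close>
  have dim: "dim_le (W N) (217 * C * (N + 1) ^ 3)" for N
  proof -
    define S where "S = {- (2 * int N)..2 * int N} - {0}"
    define cut where "cut = diag (\<lambda>a b. of_bool (\<bar>l a b\<bar> \<le> int N))"
    define lag where "lag A = diag (\<lambda>a b. \<Prod>i\<in>A. of_int (l a b - i))" for A
    have lag: "lag A v \<in> V (M + card A)" if "v \<in> V M" "finite A" for A v M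
      using that(2)
    proof (induction A rule: finite_induct)
      case empty
      have "lag {} v = v" by (rule series_eqI) (simp add: lag_def)
      then show ?case using that(1) by simp
    next
      case (insert i A)
      have "lag (insert i A) v = \<theta> (lag A v) - qscale (of_int i) (lag A v)"
        using insert(1,2) by (intro series_eqI) (simp add: lag_def \<theta>_def algebra_simps)
      moreover have "\<theta> (lag A v) \<in> V (Suc (M + card A))"
        by (rule V_op[OF _ insert.IH]) simp
      moreover have "lag A v \<in> V (Suc (M + card A))"
        by (rule bernstein_mono[OF V(1) _ insert.IH]) simp
      ultimately show ?case
        using insert(1,2) bernstein_subspace[OF V(1)]
        by (simp add: Q.subspace_diff Q.subspace_scale)
    qed
    have "z k * zero v \<in> Q.span (cut ` V (6 * N))" if k: "\<bar>k\<bar> \<le> int N" and v: "v \<in> V N" for k v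
    proof -
      define c :: rat where "c = (\<Prod>i\<in>S. of_int (- i))"
      have "c \<noteq> 0" by (simp add: c_def S_def)
      have prod: "(\<Prod>i\<in>S. of_int (m - i)) = (if m = 0 then c else 0)"
        if "\<bar>m\<bar> \<le> 2 * int N" for m
        using that by (auto simp: c_def S_def)
      have "cf (cut (z k * lag S v)) n a b = c * cf (z k * zero v) n a b" for n a b
        using prod[of "l a b - k"] k
        by (auto simp: cut_def lag_def zero_def z_def cf_mon_mult)
      then have "z k * zero v = qscale (1 / c) (cut (z k * lag S v))"
        using \<open>c \<noteq> 0\<close> by (intro series_eqI) simp
      moreover have "z k * lag S v \<in> V (6 * N)"
      proof (rule bernstein_mono[OF V(1) _ bernstein_mon[OF V(1) lag[OF v], of S 0 "k * e1" "k * e2",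
            folded z_def]])
        show "finite S" by (simp add: S_def)
        have "card S = 4 * N" by (simp add: S_def card_Diff_singleton)
        then show "N + card S + 0 + nat \<bar>k * e1\<bar> + nat \<bar>k * e2\<bar> \<le> 6 * N"
          using e k by auto
      qed
      ultimately show ?thesis by (simp only: Q.span_scale Q.span_base imageI)
    qed
    then have "Q.span (G N) \<subseteq> Q.span (pos ` V N \<union> cut ` V (6 * N))"
      using Q.span_mono[of "cut ` V (6 * N)" "pos ` V N \<union> cut ` V (6 * N)"]
      by (intro Q.span_minimal) (auto simp: G_def intro: Q.span_base)
    then have "dim_le (W N) (C * (N + 1) ^ 3 + C * (6 * N + 1) ^ 3)"
      unfolding W_def pos_def cut_def
      by (rule dim_le_Un_image[OF C C qlinear_diag qlinear_diag])
    moreover have "C * (6 * N + 1) ^ 3 \<le> C * (6 * (N + 1)) ^ 3"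
      by (intro mult_left_mono nat_cube_mono) auto
    then have "C * (N + 1) ^ 3 + C * (6 * N + 1) ^ 3 \<le> 217 * C * (N + 1) ^ 3"
      unfolding power_mult_distrib by simp
    ultimately show ?thesis unfolding dim_le_def by (meson le_trans)
  qed
  have "bernstein_filtration W"
    unfolding bernstein_filtration_def using op dim by (auto simp: W_def)
  moreover have "pos F \<in> W 0" by (rule pos_W[OF V(2)])
  ultimately show ?thesis
    unfolding holonomic_def pos_def l_def by blast
qed


section \<open>Walks sorted by their last step\<close>

text \<open>
  The weight \<open>\<phi>\<close> of the endpoint is left arbitrary: monomials, reflected monomials and monomials
  restricted to an axis are all needed.
\<close>

definition walk_sum :: "step \<Rightarrow> (int \<Rightarrow> int \<Rightarrow> laurent) \<Rightarrow> nat \<Rightarrow> laurent" where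
  "walk_sum s \<phi> m = (\<Sum>w | w \<in> quarter_plane_spiral_walks \<and> last w = s \<and> length w = m.
     \<phi> (xpos w) (ypos w))"

fun right_turn :: "step \<Rightarrow> step" where
  "right_turn East = South"
| "right_turn North = East"
| "right_turn West = North"
| "right_turn South = West"

lemma left_turn_iff: "s = left_turn p \<longleftrightarrow> p = right_turn s"
  by (cases p; cases s) auto

lemma right_turn_neq: "right_turn s \<noteq> s"
  by (cases s) auto

abbreviation walks :: "step \<Rightarrow> nat \<Rightarrow> step list set" where
  "walks s m \<equiv> {w. w \<in> quarter_plane_spiral_walks \<and> last w = s \<and> length w = m}"

lemma finite_walks: "finite (walks s m)"
proof -
  have "finite (UNIV :: step set)"
    by (rule finite_subset[of _ "{East, North, West, South}"]) (use step.exhaust in auto)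
  then show ?thesis
    by (rule finite_subset[rotated, OF finite_lists_length_eq[of UNIV m]]) auto
qed

lemma xpos_append [simp]: "xpos (w @ [s]) = xpos w + fst (step_vec s)"
  and ypos_append [simp]: "ypos (w @ [s]) = ypos w + snd (step_vec s)"
  by (simp_all add: xpos_def ypos_def)

lemma in_quarter_plane_snoc:
  "in_quarter_plane (w @ [s]) \<longleftrightarrow> in_quarter_plane w \<and>
     0 \<le> xpos w + fst (step_vec s) \<and> 0 \<le> ypos w + snd (step_vec s)"
  unfolding in_quarter_plane_def by (auto simp: le_Suc_eq)

lemma in_quarter_plane_pos: "in_quarter_plane w \<Longrightarrow> 0 \<le> xpos w \<and> 0 \<le> ypos w"
  unfolding in_quarter_plane_def by (metis order_refl take_all)

lemma walk_snoc_iff: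
  assumes "w \<noteq> []"
  shows "w @ [s] \<in> quarter_plane_spiral_walks \<longleftrightarrow> w \<in> quarter_plane_spiral_walks \<and>
    (last w = s \<or> last w = right_turn s) \<and>
    0 \<le> xpos w + fst (step_vec s) \<and> 0 \<le> ypos w + snd (step_vec s)"
  using assms
  by (auto simp: quarter_plane_spiral_walks_def spiral_def successively_append_iff
      in_quarter_plane_snoc left_turn_iff)

lemma walks_Suc:
  assumes "0 < m"
  shows "walks s (Suc m) = (\<lambda>w. w @ [s]) ` {w \<in> walks s m \<union> walks (right_turn s) m.
    0 \<le> xpos w + fst (step_vec s) \<and> 0 \<le> ypos w + snd (step_vec s)}" (is "?L = ?R")
proof (intro equalityI subsetI)
  fix v assume v: "v \<in> ?L"
  then obtain w where w: "v = w @ [s]" "length w = m"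
    by (cases v rule: rev_cases) auto
  then show "v \<in> ?R" using v assms walk_snoc_iff[of w s] by (auto intro!: image_eqI[of _ _ w])
next
  fix v assume v: "v \<in> ?R"
  then obtain w where w: "v = w @ [s]" "w \<in> walks s m \<union> walks (right_turn s) m"
    "0 \<le> xpos w + fst (step_vec s)" "0 \<le> ypos w + snd (step_vec s)" by blast
  then show "v \<in> ?L" using assms walk_snoc_iff[of w s] by (auto simp: quarter_plane_spiral_walks_def)
qed

text \<open>
  Removal of the last step, with the condition that this step stays in the quarter plane moved into the
  weight; a walk of length \<open>0\<close> has no last step, hence \<open>m > 0\<close>.
\<close>

lemma walk_sum_Suc:
  assumes "0 < m"
  shows "walk_sum s \<phi> (Suc m) = walk_sum s (\<lambda>a b. if 0 \<le> a + fst (step_vec s) \<and> 0 \<le> b + snd (step_vec s)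
      then \<phi> (a + fst (step_vec s)) (b + snd (step_vec s)) else 0) m
    + walk_sum (right_turn s) (\<lambda>a b. if 0 \<le> a + fst (step_vec s) \<and> 0 \<le> b + snd (step_vec s)
      then \<phi> (a + fst (step_vec s)) (b + snd (step_vec s)) else 0) m" (is "_ = walk_sum _ ?\<psi> m + _")
proof -
  have "walk_sum s \<phi> (Suc m) = (\<Sum>w\<in>{w \<in> walks s m \<union> walks (right_turn s) m.
    0 \<le> xpos w + fst (step_vec s) \<and> 0 \<le> ypos w + snd (step_vec s)}.
     \<phi> (xpos (w @ [s])) (ypos (w @ [s])))"
    unfolding walk_sum_def walks_Suc[OF assms] by (subst sum.reindex) (auto simp: inj_on_def)
  also have "\<dots> = (\<Sum>w\<in>walks s m \<union> walks (right_turn s) m. ?\<psi> (xpos w) (ypos w))"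
    by (subst sum.inter_filter) (simp_all add: finite_walks cong: if_cong)
  also have "\<dots> = walk_sum s ?\<psi> m + walk_sum (right_turn s) ?\<psi> m"
    unfolding walk_sum_def by (rule sum.union_disjoint) (use right_turn_neq[of s] finite_walks in auto)
  finally show ?thesis .
qed

lemma walk_sum_0: "walk_sum s \<phi> 0 = 0"
proof -
  have "walks s 0 = {}" by (auto simp: quarter_plane_spiral_walks_def)
  then show ?thesis unfolding walk_sum_def by (simp only: sum.empty)
qed

lemma walk_sum_1: "walk_sum s \<phi> (Suc 0) = (if s = East then \<phi> 1 0 else if s = North then \<phi> 0 1 else 0)"
proof -
  have "w \<in> walks s (Suc 0) \<longleftrightarrow> w = [s] \<and> (s = East \<or> s = North)" for w
    by (cases s) (auto simp: quarter_plane_spiral_walks_def spiral_def in_quarter_plane_def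
      xpos_def ypos_def length_Suc_conv le_Suc_eq)
  then have "walks s (Suc 0) = (if s = East \<or> s = North then {[s]} else {})"
    by auto
  then show ?thesis unfolding walk_sum_def by (simp add: xpos_def ypos_def)
qed

lemma walk_sum_cong:
  assumes "\<And>a b. 0 \<le> a \<Longrightarrow> 0 \<le> b \<Longrightarrow> \<phi> a b = \<psi> a b"
  shows "walk_sum s \<phi> m = walk_sum s \<psi> m"
  unfolding walk_sum_def
  by (rule sum.cong) (use assms in_quarter_plane_pos in \<open>auto simp: quarter_plane_spiral_walks_def\<close>)

lemma walk_sum_diff: "walk_sum s (\<lambda>a b. \<phi> a b - \<psi> a b) m = walk_sum s \<phi> m - walk_sum s \<psi> m"
  and walk_sum_mult: "walk_sum s (\<lambda>a b. p * \<phi> a b) m = p * walk_sum s \<phi> m"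
  by (simp_all add: walk_sum_def sum_subtractf sum_distrib_left)

lemma Q_e_nth: "fps_nth Q_e m = walk_sum East xy_mono m"
  unfolding Q_e_def walk_sum_def east_walks_def by simp

text \<open>
  Unfolding the recursion down to length \<open>1\<close> turns each coefficient into an explicit sum over sequences
  of last steps, in which the conditions on the positions are numerical.
\<close>

lemma Q_e_expansion:
  "fps_nth Q_e 0 = 0" "fps_nth Q_e 1 = xy_mono 1 0" "fps_nth Q_e 2 = xy_mono 2 0"
  "fps_nth Q_e 3 = xy_mono 3 0" "fps_nth Q_e 4 = xy_mono 4 0"
  "fps_nth Q_e 5 = xy_mono 1 0 + xy_mono 5 0"
  "fps_nth Q_e 6 = 2 * xy_mono 2 0 + xy_mono 6 0 + xy_mono 1 1"
  by (simp_all add: Q_e_nth walk_sum_0 walk_sum_1 walk_sum_Suc numeral_eq_Suc algebra_simps)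


section \<open>The kernel method\<close>

definition walk_series :: "step \<Rightarrow> (int \<Rightarrow> int \<Rightarrow> laurent) \<Rightarrow> series" where
  "walk_series s \<phi> = Abs_fps (walk_sum s \<phi>)"

text \<open>
  With signs \<open>\<sigma>, \<tau>\<close> this weight produces the series in \<open>x\<^sup>\<sigma>\<close> and \<open>y\<^sup>\<tau>\<close>, so that the reflections
  \<open>x \<mapsto> 1/x\<close> and \<open>y \<mapsto> 1/y\<close> need no substitution homomorphism.
\<close>

definition reflected_mono :: "int \<Rightarrow> int \<Rightarrow> int \<Rightarrow> int \<Rightarrow> laurent" where
  "reflected_mono \<sigma> \<tau> a b = xy_mono (\<sigma> * a) (\<tau> * b)"

text \<open>
  The series \<open>V\<close> and \<open>H\<close> of the walks to which a west or a south step, respectively, may not be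
  appended because it would leave the quarter plane. They depend on one of the two signs only, which is what
  lets them cancel later.
\<close>

definition west_boundary :: "int \<Rightarrow> series" where
  "west_boundary \<tau> = walk_series West (\<lambda>a b. if a = 0 then xy_mono 0 (\<tau> * b) else 0)
     + walk_series North (\<lambda>a b. if a = 0 then xy_mono 0 (\<tau> * b) else 0)"

definition south_boundary :: "int \<Rightarrow> series" where
  "south_boundary \<sigma> = walk_series South (\<lambda>a b. if b = 0 then xy_mono (\<sigma> * a) 0 else 0)
     + walk_series West (\<lambda>a b. if b = 0 then xy_mono (\<sigma> * a) 0 else 0)"

text \<open>
  All four equations come from \<open>walk_sum_Suc\<close>. The term \<open>1\<close> accounts for the first step, which can only be
  east or north. A west step contributes \<open>1/x\<close> times the weight except when it starts on \<open>x = 0\<close>;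
  multiplying by \<open>x\<close> keeps the equation polynomial.
\<close>

lemma last_step_equations:
  fixes \<sigma> \<tau> :: int
  defines "X \<equiv> fps_const (xy_mono \<sigma> 0)" and "Y \<equiv> fps_const (xy_mono 0 \<tau>)"
    and "E \<equiv> walk_series East (reflected_mono \<sigma> \<tau>)" and "N \<equiv> walk_series North (reflected_mono \<sigma> \<tau>)"
    and "W \<equiv> walk_series West (reflected_mono \<sigma> \<tau>)" and "S \<equiv> walk_series South (reflected_mono \<sigma> \<tau>)"
  shows "E = fps_X * X * (1 + E + S)"
    and "N = fps_X * Y * (1 + N + E)"
    and "X * W = fps_X * (W + N - west_boundary \<tau>)"
    and "Y * S = fps_X * (S + W - south_boundary \<sigma>)"
proof -
  note nth = walk_series_def fps_X_mult_nth mult.assoc fps_mult_left_const_nth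
  have E: "walk_sum East (reflected_mono \<sigma> \<tau>) (Suc m) = xy_mono \<sigma> 0 *
      (walk_sum East (reflected_mono \<sigma> \<tau>) m + walk_sum South (reflected_mono \<sigma> \<tau>) m)" if "0 < m" for m
    unfolding walk_sum_Suc[OF that] distrib_left walk_sum_mult[symmetric] right_turn.simps
    by (intro arg_cong2[of _ _ _ _ "(+)"] walk_sum_cong)
       (simp_all add: reflected_mono_def xy_mono_mult algebra_simps)
  have N: "walk_sum North (reflected_mono \<sigma> \<tau>) (Suc m) = xy_mono 0 \<tau> *
      (walk_sum North (reflected_mono \<sigma> \<tau>) m + walk_sum East (reflected_mono \<sigma> \<tau>) m)" if "0 < m" for m
    unfolding walk_sum_Suc[OF that] distrib_left walk_sum_mult[symmetric] right_turn.simps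
    by (intro arg_cong2[of _ _ _ _ "(+)"] walk_sum_cong)
       (simp_all add: reflected_mono_def xy_mono_mult algebra_simps)
  have W: "xy_mono \<sigma> 0 * walk_sum West (reflected_mono \<sigma> \<tau>) (Suc m) =
      walk_sum West (reflected_mono \<sigma> \<tau>) m + walk_sum North (reflected_mono \<sigma> \<tau>) m
      - (walk_sum West (\<lambda>a b. if a = 0 then xy_mono 0 (\<tau> * b) else 0) m
        + walk_sum North (\<lambda>a b. if a = 0 then xy_mono 0 (\<tau> * b) else 0) m)" if "0 < m" for m
    unfolding walk_sum_Suc[OF that] distrib_left walk_sum_mult[symmetric] right_turn.simps
      add_diff_add walk_sum_diff[symmetric]
    by (intro arg_cong2[of _ _ _ _ "(+)"] walk_sum_cong)
       (auto simp: reflected_mono_def xy_mono_mult algebra_simps)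
  have S: "xy_mono 0 \<tau> * walk_sum South (reflected_mono \<sigma> \<tau>) (Suc m) =
      walk_sum South (reflected_mono \<sigma> \<tau>) m + walk_sum West (reflected_mono \<sigma> \<tau>) m
      - (walk_sum South (\<lambda>a b. if b = 0 then xy_mono (\<sigma> * a) 0 else 0) m
        + walk_sum West (\<lambda>a b. if b = 0 then xy_mono (\<sigma> * a) 0 else 0) m)" if "0 < m" for m
    unfolding walk_sum_Suc[OF that] distrib_left walk_sum_mult[symmetric] right_turn.simps
      add_diff_add walk_sum_diff[symmetric]
    by (intro arg_cong2[of _ _ _ _ "(+)"] walk_sum_cong)
       (auto simp: reflected_mono_def xy_mono_mult algebra_simps)
  have ext: "F = G" if "fps_nth F 0 = fps_nth G 0" "fps_nth F 1 = fps_nth G 1"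
    "\<And>m. 0 < m \<Longrightarrow> fps_nth F (Suc m) = fps_nth G (Suc m)" for F G :: series
    using that by (intro fps_ext) (metis One_nat_def gr0_conv_Suc not0_implies_Suc)
  show "E = fps_X * X * (1 + E + S)"
    unfolding E_def S_def X_def
    by (rule ext) (simp_all add: nth E walk_sum_0 walk_sum_1 reflected_mono_def)
  show "N = fps_X * Y * (1 + N + E)"
    unfolding E_def N_def Y_def
    by (rule ext) (simp_all add: nth N walk_sum_0 walk_sum_1 reflected_mono_def)
  show "X * W = fps_X * (W + N - west_boundary \<tau>)"
    unfolding W_def N_def X_def west_boundary_def
    by (rule ext) (simp_all add: nth W walk_sum_0 walk_sum_1)
  show "Y * S = fps_X * (S + W - south_boundary \<sigma>)"
    unfolding W_def S_def Y_def south_boundary_def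
    by (rule ext) (simp_all add: nth S walk_sum_0 walk_sum_1)
qed

text \<open>
  Substituting the equations into each other along the cycle east, south, west, north, east; each
  substitution is multiplied by the factor that clears its denominator.
\<close>

lemma kernel_equation:
  fixes t x y E N W S V H :: "'a::comm_ring_1"
  assumes E: "E = t * x * (1 + E + S)" and N: "N = t * y * (1 + N + E)"
    and W: "x * W = t * (W + N - V)" and S: "y * S = t * (S + W - H)"
  shows "((1 - t * x) * (y - t) * (x - t) * (1 - t * y) - t ^ 4 * x * y) * E =
    t * x * ((y - t) * (x - t) * (1 - t * y) + t ^ 3 * y - t\<^sup>2 * (1 - t * y) * V
      - t * (x - t) * (1 - t * y) * H)"
proof -
  have E': "(1 - t * x) * E = t * x * (1 + S)" using E by (simp add: algebra_simps)
  have N': "(1 - t * y) * N = t * y * (1 + E)" using N by (simp add: algebra_simps)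
  have W': "(x - t) * W = t * (N - V)" using W by (simp add: algebra_simps)
  have S': "(y - t) * S = t * (W - H)" using S by (simp add: algebra_simps)
  have "(1 - t * x) * (y - t) * (x - t) * (1 - t * y) * E
      = (y - t) * (x - t) * (1 - t * y) * ((1 - t * x) * E)" by (simp only: mult_ac)
  also have "\<dots> = t * x * ((y - t) * (x - t) * (1 - t * y) + (x - t) * (1 - t * y) * ((y - t) * S))"
    unfolding E' by (simp add: algebra_simps)
  also have "(x - t) * (1 - t * y) * ((y - t) * S)
      = t * (1 - t * y) * ((x - t) * W) - t * (x - t) * (1 - t * y) * H"
    unfolding S' by (simp add: algebra_simps)
  also have "t * (1 - t * y) * ((x - t) * W) = t\<^sup>2 * ((1 - t * y) * N) - t\<^sup>2 * (1 - t * y) * V"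
    unfolding W' by (simp add: algebra_simps power2_eq_square)
  also have "t\<^sup>2 * ((1 - t * y) * N) = t ^ 3 * y + t ^ 3 * y * E"
    unfolding N' by (simp add: algebra_simps eval_nat_numeral)
  finally show ?thesis by (simp add: algebra_simps eval_nat_numeral)
qed

text \<open>
  Multiplying the reflected equations by \<open>x\<^sup>2\<close>, \<open>y\<^sup>2\<close> and \<open>x\<^sup>2 y\<^sup>2\<close> restores the kernel of the first one,
  because \<open>x (1 - t/x) = x - t\<close> and \<open>x (1/x - t) = 1 - tx\<close>. Afterwards the coefficients of \<open>V\<close> agree in
  \<open>E1\<close> and \<open>E2\<close>, and those of \<open>V'\<close> in \<open>E3\<close> and \<open>E4\<close>. Those of \<open>H\<close> in \<open>E1\<close> and \<open>E3\<close> differ by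
  the factor \<open>y(y-t)/(1-ty)\<close>, as do those of \<open>H'\<close> in \<open>E2\<close> and \<open>E4\<close>, and this is the ratio of the factors in
  the combination.
\<close>

lemma antisymmetrised_kernel_equation:
  fixes t x y x' y' E1 E2 E3 E4 V V' H H' :: "'a::comm_ring_1"
  assumes inv: "x * x' = 1" "y * y' = 1"
    and E1: "((1 - t * x) * (y - t) * (x - t) * (1 - t * y) - t ^ 4 * x * y) * E1 =
      t * x * ((y - t) * (x - t) * (1 - t * y) + t ^ 3 * y - t\<^sup>2 * (1 - t * y) * V
      - t * (x - t) * (1 - t * y) * H)"
    and E2: "((1 - t * x') * (y - t) * (x' - t) * (1 - t * y) - t ^ 4 * x' * y) * E2 =
      t * x' * ((y - t) * (x' - t) * (1 - t * y) + t ^ 3 * y - t\<^sup>2 * (1 - t * y) * V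
      - t * (x' - t) * (1 - t * y) * H')"
    and E3: "((1 - t * x) * (y' - t) * (x - t) * (1 - t * y') - t ^ 4 * x * y') * E3 =
      t * x * ((y' - t) * (x - t) * (1 - t * y') + t ^ 3 * y' - t\<^sup>2 * (1 - t * y') * V'
      - t * (x - t) * (1 - t * y') * H)"
    and E4: "((1 - t * x') * (y' - t) * (x' - t) * (1 - t * y') - t ^ 4 * x' * y') * E4 =
      t * x' * ((y' - t) * (x' - t) * (1 - t * y') + t ^ 3 * y' - t\<^sup>2 * (1 - t * y') * V'
      - t * (x' - t) * (1 - t * y') * H')"
  shows "((1 - t * x) * (y - t) * (x - t) * (1 - t * y) - t ^ 4 * x * y) *
      (y * (y - t) * (E1 - E2) - (1 - t * y) * (E3 - E4)) =
    t * (y - t) * (1 - t * y) * (x\<^sup>2 - 1) * (y\<^sup>2 - 1)"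
proof -
  define K where "K = (1 - t * x) * (y - t) * (x - t) * (1 - t * y) - t ^ 4 * x * y"
  have xs: "x * (1 - t * x') = x - t" "x * (x' - t) = 1 - t * x"
    and ys: "y * (1 - t * y') = y - t" "y * (y' - t) = 1 - t * y"
    using inv by (simp_all add: algebra_simps)
  have K2: "K * E2 = t * ((y - t) * (1 - t * x) * (1 - t * y) + t ^ 3 * x * y
      - t\<^sup>2 * x * (1 - t * y) * V - t * (1 - t * x) * (1 - t * y) * H')"
  proof -
    have K: "K = (x * (1 - t * x')) * (y - t) * (x * (x' - t)) * (1 - t * y) - t ^ 4 * x * (x * x') * y"
      unfolding K_def xs inv by simp
    have "K * E2 = x * x * (((1 - t * x') * (y - t) * (x' - t) * (1 - t * y) - t ^ 4 * x' * y) * E2)"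
      unfolding K by (simp add: algebra_simps)
    also have "\<dots> = t * (x * x') * ((y - t) * (x * (x' - t)) * (1 - t * y) + t ^ 3 * x * y
      - t\<^sup>2 * x * (1 - t * y) * V - t * (x * (x' - t)) * (1 - t * y) * H')"
      unfolding E2 by (simp add: algebra_simps)
    finally show ?thesis unfolding xs inv by simp
  qed
  have K3: "K * E3 = t * x * ((1 - t * y) * (x - t) * (y - t) + t ^ 3 * y
      - t\<^sup>2 * y * (y - t) * V' - t * (x - t) * y * (y - t) * H)"
  proof -
    have K: "K = (1 - t * x) * (y * (y' - t)) * (x - t) * (y * (1 - t * y')) - t ^ 4 * x * y * (y * y')"
      unfolding K_def ys inv by (simp add: mult_ac)
    have "K * E3 = y * y * (((1 - t * x) * (y' - t) * (x - t) * (1 - t * y') - t ^ 4 * x * y') * E3)"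
      unfolding K by (simp add: algebra_simps)
    also have "\<dots> = t * x * ((y * (y' - t)) * (x - t) * (y * (1 - t * y')) + t ^ 3 * y * (y * y')
      - t\<^sup>2 * y * (y * (1 - t * y')) * V' - t * (x - t) * y * (y * (1 - t * y')) * H)"
      unfolding E3 by (simp add: algebra_simps)
    finally show ?thesis unfolding ys inv by simp
  qed
  have K4: "K * E4 = t * ((1 - t * y) * (1 - t * x) * (y - t) + t ^ 3 * x * y
      - t\<^sup>2 * x * y * (y - t) * V' - t * (1 - t * x) * y * (y - t) * H')"
  proof -
    have K: "K = (x * (1 - t * x')) * (y * (y' - t)) * (x * (x' - t)) * (y * (1 - t * y'))
        - t ^ 4 * x * (x * x') * y * (y * y')"
      unfolding K_def xs ys inv by (simp add: mult_ac)
    have "K * E4 = x * x * (y * y) *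
        (((1 - t * x') * (y' - t) * (x' - t) * (1 - t * y') - t ^ 4 * x' * y') * E4)"
      unfolding K by (simp add: algebra_simps)
    also have "\<dots> = t * (x * x') * ((y * (y' - t)) * (x * (x' - t)) * (y * (1 - t * y'))
      + t ^ 3 * x * y * (y * y') - t\<^sup>2 * x * y * (y * (1 - t * y')) * V'
      - t * (x * (x' - t)) * y * (y * (1 - t * y')) * H')"
      unfolding E4 by (simp add: algebra_simps)
    finally show ?thesis unfolding xs ys inv by simp
  qed
  have "K * (y * (y - t) * (E1 - E2) - (1 - t * y) * (E3 - E4)) =
      y * (y - t) * (K * E1 - K * E2) - (1 - t * y) * (K * E3 - K * E4)"
    by (simp add: algebra_simps)
  also have "\<dots> = t * (y - t) * (1 - t * y) * (x\<^sup>2 - 1) * (y\<^sup>2 - 1)"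
    unfolding K2 K3 K4 E1[folded K_def] by (simp add: algebra_simps eval_nat_numeral)
  finally show ?thesis unfolding K_def .
qed

text \<open>
  A walk that ends with an east step ends strictly to the right of the \<open>y\<close>-axis.
\<close>

lemma cf_east_series_support:
  assumes "cf (walk_series East (reflected_mono \<sigma> \<tau>)) n i j \<noteq> 0"
  shows "\<exists>a b. 0 < a \<and> 0 \<le> b \<and> i = \<sigma> * a \<and> j = \<tau> * b"
proof -
  have "\<exists>w\<in>walks East n. Poly_Mapping.lookup (Poly_Mapping.lookup
      (reflected_mono \<sigma> \<tau> (xpos w) (ypos w)) j) i \<noteq> 0"
    using assms by (auto simp: cf_def walk_series_def walk_sum_def lookup_sum elim: sum.not_neutral_contains_not_neutral)
  then obtain w where w: "w \<in> quarter_plane_spiral_walks" "last w = East"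
    "i = \<sigma> * xpos w" "j = \<tau> * ypos w"
    by (auto simp: reflected_mono_def xy_mono_def lookup_single when_def split: if_splits)
  obtain v where v: "w = v @ [East]" 
    using w(1,2) by (cases w rule: rev_cases) (auto simp: quarter_plane_spiral_walks_def)
  have "in_quarter_plane w" using w(1) by (simp add: quarter_plane_spiral_walks_def)
  then have "in_quarter_plane v" unfolding v by (simp add: in_quarter_plane_snoc)
  then have "0 < xpos w" "0 \<le> ypos w"
    using in_quarter_plane_pos[of v] by (simp_all add: v)
  then show ?thesis using w by blast
qed


section \<open>Extraction of the positive part\<close>

abbreviation T :: series where "T \<equiv> mon 1 0 0"
abbreviation X :: series where "X \<equiv> mon 0 1 0"
abbreviation Y :: series where "Y \<equiv> mon 0 0 1"
abbreviation east :: "int \<Rightarrow> int \<Rightarrow> series" where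
  "east \<sigma> \<tau> \<equiv> walk_series East (reflected_mono \<sigma> \<tau>)"

definition kernel_poly :: series where
  "kernel_poly = (1 - T * X) * (Y - T) * (X - T) * (1 - T * Y) - T ^ 4 * X * Y"

lemma mon_fps: "fps_X = T" "fps_const (xy_mono i 0) = mon 0 i 0" "fps_const (xy_mono 0 j) = mon 0 0 j"
  by (simp_all add: mon_def xy_mono_0_0)

lemma Q_e_eq: "Q_e = east 1 1"
proof -
  have "reflected_mono 1 1 = xy_mono" by (intro ext) (simp add: reflected_mono_def)
  then show ?thesis by (intro fps_ext) (simp add: Q_e_nth walk_series_def)
qed

lemma antisymmetrised_east:
  "kernel_poly * (Y * (Y - T) * (east 1 1 - east (-1) 1) - (1 - T * Y) * (east 1 (-1) - east (-1) (-1)))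
    = T * (Y - T) * (1 - T * Y) * (X\<^sup>2 - 1) * (Y\<^sup>2 - 1)"
proof -
  note eqs = last_step_equations[unfolded mon_fps]
  have inv: "X * mon 0 (-1) 0 = 1" "Y * mon 0 0 (-1) = 1"
    by (simp_all add: mon_mult)
  show ?thesis
    unfolding kernel_poly_def
    by (rule antisymmetrised_kernel_equation[OF inv
          kernel_equation[OF eqs[where \<sigma> = 1 and \<tau> = 1]] kernel_equation[OF eqs[where \<sigma> = "-1" and \<tau> = 1]]
          kernel_equation[OF eqs[where \<sigma> = 1 and \<tau> = "-1"]] kernel_equation[OF eqs[where \<sigma> = "-1" and \<tau> = "-1"]]])
qed

text \<open>
  The expansion of \<open>t/(x-t)\<close>; a multiple of it separates \<open>RHS_e\<close> from the antisymmetrised series.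
\<close>

definition negative_tail :: series where
  "negative_tail = Abs_fps (\<lambda>n. if n = 0 then 0 else xy_mono (- int n) 0)"

lemma cf_negative_tail: "cf negative_tail n a b = (if 0 < n \<and> a = - int n \<and> b = 0 then 1 else 0)"
  by (auto simp: cf_def negative_tail_def xy_mono_def lookup_single when_def)

lemma negative_tail: "(X - T) * negative_tail = T"
proof (rule series_eqI)
  fix n a b
  show "cf ((X - T) * negative_tail) n a b = cf T n a b"
    unfolding left_diff_distrib cf_diff cf_mon_mult cf_negative_tail cf_mon
    by (cases n) auto
qed

lemma cf_nonzero: "cf F n a b \<noteq> 0 \<Longrightarrow> F \<noteq> 0"
  by auto

lemma nonzero_factors: "X - T \<noteq> 0" "Y - T \<noteq> 0" "1 - T * Y \<noteq> 0" "kernel_poly \<noteq> 0" "Y \<noteq> 0"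
proof -
  show "X - T \<noteq> 0" "Y - T \<noteq> 0"
    by (rule cf_nonzero[of _ 1 0 0], simp add: cf_mon)+
  show "1 - T * Y \<noteq> 0"
    by (rule cf_nonzero[of _ 0 0 0]) (simp add: cf_mon cf_1 mon_mult)
  show "Y \<noteq> 0"
    by (rule cf_nonzero[of _ 0 0 1]) (simp add: cf_mon)
  have "cf kernel_poly 0 1 1 = 1"
    unfolding kernel_poly_def
    by (simp add: algebra_simps mon_mult cf_mon eval_nat_numeral) (simp only: mult_2 cf_add cf_mon, simp)
  then show "kernel_poly \<noteq> 0" by (intro cf_nonzero[of _ 0 1 1]) simp
qed

text \<open>
  With \<open>m = (x-t)(y-t)(1-ty)\<close> the left-hand side is \<open>t (y\<^sup>2-1)\<close> times \<open>m (x\<^sup>2-1) + (1-tx) m - t\<^sup>4 xy\<close>,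
  in which a factor \<open>x\<close> splits off. This explains the long factor in the numerator of \<open>RHS_e\<close>: it is
  \<open>t\<^sup>4 y - (x-t)\<^sup>2 (y-t)(1-ty)\<close>.
\<close>

lemma kernel_factorisation:
  fixes t x y :: "'a::comm_ring_1"
  shows "(x - t) * (t * (y - t) * (1 - t * y) * (x\<^sup>2 - 1) * (y\<^sup>2 - 1))
      + (y\<^sup>2 - 1) * ((1 - t * x) * (y - t) * (x - t) * (1 - t * y) - t ^ 4 * x * y) * t
    = t * x * (1 - y\<^sup>2) * (t ^ 4 * y - (x - t)\<^sup>2 * (y - t) * (1 - t * y))"
proof -
  define m where "m = (x - t) * (y - t) * (1 - t * y)"
  have "(x - t) * (t * (y - t) * (1 - t * y) * (x\<^sup>2 - 1) * (y\<^sup>2 - 1)) = t * (x\<^sup>2 - 1) * (y\<^sup>2 - 1) * m"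
    and "(1 - t * x) * (y - t) * (x - t) * (1 - t * y) = (1 - t * x) * m"
    and "(x - t)\<^sup>2 * (y - t) * (1 - t * y) = (x - t) * m"
    unfolding m_def by (simp_all only: mult_ac power2_eq_square)
  then show ?thesis by (simp add: algebra_simps power2_eq_square)
qed

text \<open>
  The factor \<open>1 - B_e\<close> of the denominator is \<open>K/((x-t)(y-t)(1-ty))\<close>.
\<close>

lemma RHS_e_numerator:
  "(X - T) * (1 - T * Y) * kernel_poly * expansion RHS_e =
    - (T * X * (1 - Y\<^sup>2) * (T ^ 4 * Y - (X - T)\<^sup>2 * (Y - T) * (1 - T * Y)))"
proof -
  have xt: "vx - vt \<noteq> 0" and yt: "vy - vt \<noteq> 0" and ty: "1 - vt * vy \<noteq> 0"
    using nonzero_factors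
    by (simp_all add: mon_variables flip: to_fract_diff to_fract_mult to_fract_1)
  define k where "k = to_fract kernel_poly"
  have k: "k = (1 - vt * vx) * (vy - vt) * (vx - vt) * (1 - vt * vy) - vt ^ 4 * vx * vy"
    by (simp add: k_def kernel_poly_def mon_variables to_fract_power)
  have "k \<noteq> 0" using nonzero_factors by (simp add: k_def)
  define d where "d = (vx - vt) * (vy - vt) * (1 - vt * vy)"
  have "d \<noteq> 0" using xt yt ty by (simp add: d_def)
  have B: "d * (1 - B_e) = k"
  proof -
    have "d * (1 - B_e) = d - vt * vx * (vt^2 - vt * vx - vt * vy + vx * vy + vt^2 * vx * vy
        + vt^2 * vy^2 - vt * vx * vy^2)"
      unfolding B_e_def d_def[symmetric] using \<open>d \<noteq> 0\<close> by (simp add: right_diff_distrib[of d 1])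
    also have "\<dots> = k" unfolding d_def k by (simp add: algebra_simps eval_nat_numeral)
    finally show ?thesis .
  qed
  have den: "(vx - vt)^2 * (vy - vt) * (1 - vt * vy)^2 * (1 - B_e) = (vx - vt) * (1 - vt * vy) * k"
    unfolding B[symmetric] d_def by (simp add: power2_eq_square mult_ac)
  have "(vx - vt) * (1 - vt * vy) * k * RHS_e = - (vt * vx * (1 - vy^2) *
        (vt^3 - 2 * vt^2 * vx + vt * vx^2 - vt^2 * vy + 2 * vt * vx * vy + 2 * vt^3 * vx * vy
          - vx^2 * vy - vt^2 * vx^2 * vy + vt^3 * vy^2 - 2 * vt^2 * vx * vy^2 + vt * vx^2 * vy^2))"
    unfolding RHS_e_def den using xt ty \<open>k \<noteq> 0\<close> by simp
  also have "\<dots> = - (vt * vx * (1 - vy^2) * (vt ^ 4 * vy - (vx - vt)\<^sup>2 * (vy - vt) * (1 - vt * vy)))"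
    by (simp add: algebra_simps eval_nat_numeral)
  finally have "to_fract ((X - T) * (1 - T * Y) * kernel_poly * expansion RHS_e) =
    to_fract (- (T * X * (1 - Y\<^sup>2) * (T ^ 4 * Y - (X - T)\<^sup>2 * (Y - T) * (1 - T * Y))))"
    by (simp add: RHS_e_has_expansion k_def mon_variables to_fract_power)
  then show ?thesis by (simp only: to_fract_eq_iff)
qed

lemma cf_pos_part: "cf (pos_part F) n a b = (if 0 < a \<and> 0 < b then cf F n a b else 0)"
  by (simp add: cf_def pos_part_def lookup_pos_part_laurent)

lemma pos_part_eq_diag:
  "pos_part F = diag (\<lambda>a b. of_bool (0 < 1 * a + 0 * b)) (diag (\<lambda>a b. of_bool (0 < 0 * a + 1 * b)) F)"
  by (rule series_eqI) (auto simp: cf_pos_part)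

text \<open>
  The two occurrences of the tail add up to \<open>(y\<^sup>2-1) t/(x-t)\<close>, the discrepancy between \<open>-(1-ty) RHS_e\<close>
  and the antisymmetrised series. It is distributed over the two differences because each \<open>E(1/x,\<cdot>)\<close>, like the
  tail, has negative exponents of \<open>x\<close> only.
\<close>

lemma RHS_e_eq_east:
  "(1 - T * Y) * - expansion RHS_e =
    Y * (Y - T) * (east 1 1 - east (-1) 1 + negative_tail)
    - (1 - T * Y) * (east 1 (-1) - east (-1) (-1) + negative_tail)" (is "?L = ?R")
proof -
  define A where "A = Y * (Y - T) * (east 1 1 - east (-1) 1)
    - (1 - T * Y) * (east 1 (-1) - east (-1) (-1))"
  have A: "kernel_poly * A = T * (Y - T) * (1 - T * Y) * (X\<^sup>2 - 1) * (Y\<^sup>2 - 1)"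
    unfolding A_def by (rule antisymmetrised_east)
  have "?R = A + (Y\<^sup>2 - 1) * negative_tail"
    by (simp add: A_def algebra_simps power2_eq_square)
  then have "(X - T) * kernel_poly * ?R = (X - T) * (kernel_poly * A) + (Y\<^sup>2 - 1) * kernel_poly * ((X - T) * negative_tail)"
    by (simp only: distrib_left mult_ac)
  also have "\<dots> = T * X * (1 - Y\<^sup>2) * (T ^ 4 * Y - (X - T)\<^sup>2 * (Y - T) * (1 - T * Y))"
    unfolding A negative_tail unfolding kernel_poly_def by (rule kernel_factorisation)
  also have "\<dots> = (X - T) * kernel_poly * ?L"
    using RHS_e_numerator by (simp add: mult_ac)
  finally have "(X - T) * kernel_poly * ?R = (X - T) * kernel_poly * ?L" .
  moreover have "(X - T) * kernel_poly \<noteq> 0" using nonzero_factors by simp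
  ultimately show ?thesis using mult_left_cancel by metis
qed

text \<open>
  The auxiliary series \<open>U\<close> stands for \<open>y(y-t)/(1-ty) (E(x,y) - E(1/x,y) + t/(x-t))\<close>. Division by \<open>1-ty\<close> is
  the recursion \<open>U = A + ty U\<close>, which shows by induction on the exponent of \<open>t\<close> that \<open>U\<close> has only positive
  exponents of \<open>y\<close>. So \<open>U\<close> and \<open>-RHS_e\<close> have the same part with positive exponents of \<open>y\<close>, and the part of \<open>U\<close> with
  positive exponents of \<open>x\<close> comes from \<open>E(x,y)\<close>.
\<close>

lemma positive_part_RHS_e:
  "(1 - T * Y) * pos_part (expansion RHS_e) = - (Y * (Y - T) * Q_e)"
proof -
  define E where "E = east 1 1 - east (-1) 1 + negative_tail"
  define E' where "E' = east 1 (-1) - east (-1) (-1) + negative_tail"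
  define U where "U = E' - expansion RHS_e"
  have TY: "(1 - T * Y) * F = F - mon 1 0 1 * F" for F
    by (simp add: mon_mult left_diff_distrib)
  have YY: "Y * (Y - T) * F = mon 0 0 2 * F - mon 1 0 1 * F" for F
    by (simp add: mon_mult left_diff_distrib right_diff_distrib)
  have U: "U = mon 0 0 2 * E - mon 1 0 1 * E + mon 1 0 1 * U"
  proof -
    have "(1 - T * Y) * U = Y * (Y - T) * E"
      using RHS_e_eq_east unfolding U_def E_def E'_def by (simp add: algebra_simps)
    then show ?thesis unfolding TY YY by (simp add: algebra_simps)
  qed
  have E_support: "cf E n a b = 0" if "b < 0" for n a b
  proof -
    have "cf (east 1 1) n a b = 0" "cf (east (-1) 1) n a b = 0"
      using that cf_east_series_support[of 1 1 n a b] cf_east_series_support[of "-1" 1 n a b]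
      by fastforce+
    then show ?thesis using that by (simp add: E_def cf_negative_tail)
  qed
  have E_pos: "cf E n a b = cf Q_e n a b" if "0 < a" for n a b
  proof -
    have "cf (east (-1) 1) n a b = 0"
      using that cf_east_series_support[of "-1" 1 n a b] by fastforce
    then show ?thesis using that by (simp add: E_def cf_negative_tail Q_e_eq)
  qed
  have E'_pos: "cf E' n a b = 0" if "0 < b" for n a b
  proof -
    have "cf (east 1 (-1)) n a b = 0" "cf (east (-1) (-1)) n a b = 0"
      using that cf_east_series_support[of 1 "-1" n a b] cf_east_series_support[of "-1" "-1" n a b]
      by fastforce+
    then show ?thesis using that by (simp add: E'_def cf_negative_tail)
  qed
  have Q_support: "cf Q_e n a b = 0" if "a \<le> 0 \<or> b < 0" for n a b
    using that cf_east_series_support[of 1 1 n a b] by (fastforce simp: Q_e_eq)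
  have cf_U: "cf U n a b = cf E n a (b - 2) - (if 1 \<le> n then cf E (n - 1) a (b - 1) else 0)
      + (if 1 \<le> n then cf U (n - 1) a (b - 1) else 0)" for n a b
    using arg_cong[OF U, of "\<lambda>F. cf F n a b"] by (simp add: cf_mon_mult)
  have U_support: "cf U n a b = 0" if "b \<le> 0" for n a b
    using that
  proof (induction n arbitrary: b)
    case 0
    then show ?case by (simp add: cf_U[of 0] E_support)
  next
    case (Suc n)
    then show ?case by (simp add: cf_U[of "Suc n"] E_support)
  qed
  have "cf ((1 - T * Y) * pos_part (expansion RHS_e)) n a b = cf (- (Y * (Y - T) * Q_e)) n a b" for n a b
  proof (cases "0 < a \<and> 0 < b")
    case True
    then have pos: "0 < a" "0 < b" by auto
    have R: "cf (pos_part (expansion RHS_e)) m a c = - cf U m a c" if "0 \<le> c" for m c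
      using that E'_pos[of c m a] pos(1) U_support[of c m a]
      by (auto simp: cf_pos_part U_def)
    show ?thesis
      unfolding TY YY using pos cf_U[of n a b]
      by (simp add: cf_mon_mult R E_pos)
  next
    case False
    then show ?thesis
      unfolding TY YY by (auto simp: cf_mon_mult cf_pos_part Q_support)
  qed
  then show ?thesis by (rule series_eqI)
qed

lemma laurent_polys_1: "1 \<in> laurent_polys"
  using mon_laurent_polys[of 0 0 0] by simp

lemma laurent_polys_power: "p \<in> laurent_polys \<Longrightarrow> p ^ n \<in> laurent_polys"
  by (induction n) (simp_all add: laurent_polys_1 laurent_polys_mult)

text \<open>
  Two divisions by Laurent polynomials, with the extraction of the positive part in \<open>y\<close> and then in \<open>x\<close>
  between them.
\<close>

lemma holonomic_Q_e: "holonomic Q_e"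
proof -
  note closure = laurent_polys_1 laurent_polys_mult laurent_polys_diff laurent_polys_uminus
    laurent_polys_power mon_laurent_polys
  have "holonomic (expansion RHS_e)"
  proof (rule holonomic_quotient[OF holonomic_1])
    show "(X - T) * (1 - T * Y) * kernel_poly * expansion RHS_e =
      - (T * X * (1 - Y\<^sup>2) * (T ^ 4 * Y - (X - T)\<^sup>2 * (Y - T) * (1 - T * Y))) * 1"
      using RHS_e_numerator by simp
    show "(X - T) * (1 - T * Y) * kernel_poly \<noteq> 0" using nonzero_factors by simp
  qed (unfold kernel_poly_def, (intro closure)+)
  then have "holonomic (pos_part (expansion RHS_e))"
    unfolding pos_part_eq_diag by (intro holonomic_positive_part) auto
  then show ?thesis
  proof (rule holonomic_quotient)
    show "Y * (Y - T) * Q_e = - (1 - T * Y) * pos_part (expansion RHS_e)"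
      by (simp only: mult_minus_left positive_part_RHS_e minus_minus)
    show "Y * (Y - T) \<noteq> 0" using nonzero_factors by simp
  qed (intro closure)+
qed

section \<open>The generating function of walks ending east\<close>

theorem theorem4:
  shows
    "to_fract Q_e =
       - (inverse vy * (1 - vt * vy) / (vy - vt)) * to_fract (pos_part (expansion RHS_e))
     \<and> (\<exists>G :: series. to_fract Q_e =
          vt * vx + vt^2 * vx^2 + vt^3 * vx^3 + vt^4 * vx^4 + vt^5 * (vx + vx^5)
          + vt^6 * (2 * vx^2 + vx^6 + vx * vy) + vt^7 * to_fract G)
     \<and> D_finite Q_e"
proof (intro conjI)
  have "to_fract ((1 - T * Y) * pos_part (expansion RHS_e)) = to_fract (- (Y * (Y - T) * Q_e))"
    by (simp only: positive_part_RHS_e)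
  then have "(1 - vt * vy) * to_fract (pos_part (expansion RHS_e)) = - (vy * (vy - vt) * to_fract Q_e)"
    by (simp add: mon_variables)
  moreover have "vy \<noteq> 0" "vy - vt \<noteq> 0"
    using nonzero_factors by (simp_all add: mon_variables flip: to_fract_diff)
  ultimately show "to_fract Q_e =
       - (inverse vy * (1 - vt * vy) / (vy - vt)) * to_fract (pos_part (expansion RHS_e))"
    by (simp add: divide_simps)
  have two: "to_fract 2 = (2 :: series fract)"
    by (metis one_add_one to_fract_1 to_fract_add)
  define P where "P = T * X + T^2 * X^2 + T^3 * X^3 + T^4 * X^4 + T^5 * (X + X^5)
    + T^6 * (2 * X^2 + X^6 + X * Y)"
  define G where "G = fps_shift 7 Q_e"
  have P: "P = mon 1 1 0 + mon 2 2 0 + mon 3 3 0 + mon 4 4 0 + (mon 5 1 0 + mon 5 5 0)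
    + (2 * mon 6 2 0 + mon 6 6 0 + mon 6 1 1)"
    unfolding P_def by (simp add: eval_nat_numeral mon_mult distrib_left mult.left_commute[of _ 2])
  have mon_nth: "fps_nth (mon k i j) n = (if n = k then xy_mono i j else 0)" for k i j n
    by (simp add: mon_def fps_X_power_mult_nth)
  have double_nth: "fps_nth (2 * F) n = 2 * fps_nth F n" for F :: series and n
    by (simp only: mult_2 fps_add_nth)
  have "Q_e = P + T ^ 7 * G"
  proof (rule fps_ext)
    fix n
    have "fps_nth (T ^ 7 * G) n = (if n < 7 then 0 else fps_nth Q_e n)"
      unfolding G_def mon_fps[symmetric] by (simp add: fps_X_power_mult_nth)
    moreover have "fps_nth P n = (if n < 7 then fps_nth Q_e n else 0)"
    proof (cases "n < 7")
      case True
      then consider "n = 0" | "n = 1" | "n = 2" | "n = 3" | "n = 4" | "n = 5" | "n = 6"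
        by linarith
      then show ?thesis
        by cases (simp_all add: P double_nth mon_nth Q_e_expansion Q_e_expansion(2)[unfolded One_nat_def])
    next
      case False
      then show ?thesis by (simp add: P double_nth mon_nth)
    qed
    ultimately show "fps_nth Q_e n = fps_nth (P + T ^ 7 * G) n" by simp
  qed
  then have "to_fract Q_e = to_fract (P + T ^ 7 * G)" by simp
  then show "\<exists>G :: series. to_fract Q_e =
          vt * vx + vt^2 * vx^2 + vt^3 * vx^3 + vt^4 * vx^4 + vt^5 * (vx + vx^5)
          + vt^6 * (2 * vx^2 + vx^6 + vx * vy) + vt^7 * to_fract G"
    by (intro exI[of _ G]) (simp add: P_def mon_variables to_fract_power two)
  show "D_finite Q_e" by (rule D_finite_if_holonomic[OF holonomic_Q_e])
qed

end
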